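(* Let $n\ge1$ be an integer, let $0=\nu_1\le\nu_2\le\cdots\le\nu_n$ be fixed integers, and put $\alpha_n=\sum_{i=1}^n\nu_i$. Then for every $z$ in a compact subset of $\mathbb{C}$ and for $N$ large enough, $$\omega_{n,N}\Big(\frac{z}{N^{n/2}}\Big)\sim\frac{\pi^{n-1}}{N^{\alpha_n}}\,|z|^{2\nu_n}\;G_{0,n}^{n,0}\left(\begin{matrix}-\\ -\nu_n,\ \nu_2-\nu_n,\ldots,\nu_{n-1}-\nu_n,\ 0\end{matrix}\;\Big|\;|z|^2\right),$$ where $\sim$ denotes asymptotic equivalence as $N\to+\infty$.
   Context: For integers $n,N\ge1$ and $0=\nu_1\le\cdots\le\nu_n$, the weight $\omega_{n,N}$ is $$\omega_{n,N}(z)=\int_{\mathbb{C}^n}\prod_{j=1}^n\frac{|x_j|^{2\nu_j}}{(1+|x_j|^2)^{\nu_j+N+1}}\;\delta\Big(z-\prod_{j=1}^n x_j\Big)\,d^2x_1\cdots d^2x_n ,$$ where $d^2x$ is Lebesgue measure on $\mathbb{C}$ and $\delta$ is the Dirac delta on $\mathbb{C}$; in polar coordinates this is written $$\omega_{n,N}(z)=(2\pi)^{n-1}\int_{(0,\infty)^{n-1}}\frac{|z|^{2\nu_n}}{\big(1+\frac{|z|^2}{r_1^2\cdots r_{n-1}^2}\big)^{\nu_n+N+1}}\prod_{j=1}^{n-1}\frac{r_j^{2\nu_j-2\nu_n-1}}{(1+r_j^2)^{\nu_j+N+1}}\,dr_1\cdots dr_{n-1}$$ (for $n=1$ there is no integration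 and $\omega_{1,N}(z)=(1+|z|^2)^{-N-1}$). $G_{0,n}^{n,0}$ is the Meijer G-function, given by the Mellin-Barnes integral $$G_{0,n}^{n,0}\left(\begin{matrix}-\\ b_1,\ldots,b_n\end{matrix}\Big|\,x\right)=\frac1{2\pi i}\int_{c-i\infty}^{c+i\infty}\prod_{j=1}^n\Gamma(b_j+s)\;x^{-s}\,ds,\qquad c>-\min_j b_j .$$ The lower parameters in the claim are $b_j=\nu_j-\nu_n$, $j=1,\dots,n$ (with $\nu_1=0$); for $n=1$ the list consists of the single parameter $0$. *)

theory Defs
  imports "HOL-Analysis.Analysis" "HOL-Library.Landau_Symbols"
begin

unbundle asymp_equiv_syntax

text \<open>
  \<open>prod_weight n \<nu> N z\<close> is the weight
  \<^emph>\<open>integral over C^n of  prod_j |x_j|^(2 nu_j) / (1 + |x_j|^2)^(nu_j + N + 1)  delta(z - prod_j x_j)\<close>,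
  with the delta function resolved and the angles integrated out (polar coordinates), which leaves
  the radii \<open>r 1, \<dots>, r (n-1)\<close> in \<open>(0,\<infinity>)\<close>.
  For \<open>n = 1\<close> the integral is over the one-point space \<open>Pi\<^sub>M {}\<close> of total mass 1, so that the
  value is just the integrand \<open>|z|^(2 \<nu> 1) / (1 + |z|^2)^(\<nu> 1 + N + 1)\<close>.
  For \<open>n \<ge> 2\<close> and \<open>z = 0\<close> the expression has no meaning: the integral of the radial factors
  diverges, while the prefactor is \<open>0\<close> unless \<open>\<nu> n = 0\<close>.
\<close>

definition prod_weight :: "nat \<Rightarrow> (nat \<Rightarrow> int) \<Rightarrow> nat \<Rightarrow> complex \<Rightarrow> real" where
  "prod_weight n \<nu> N z =
     (2 * pi) ^ (n - 1) *
     (LINT r : (\<Pi>\<^sub>E j\<in>{1..<n}. {0<..}) | (\<Pi>\<^sub>M j\<in>{1..<n}. lborel).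
        cmod z powi (2 * \<nu> n)
          / (1 + (cmod z)\<^sup>2 / (\<Prod>j\<in>{1..<n}. (r j)\<^sup>2)) powi (\<nu> n + int N + 1)
        * (\<Prod>j\<in>{1..<n}. r j powi (2 * \<nu> j - 2 * \<nu> n - 1)
                           / (1 + (r j)\<^sup>2) powi (\<nu> j + int N + 1)))"

text \<open>
  The Meijer function $G_{0,n}^{n,0}$ with lower parameters \<open>b 1, \<dots>, b n\<close>, for \<open>x > 0\<close>, as a
  Mellin-Barnes integral along \<open>s = c + i t\<close>, so that \<open>ds = i dt\<close>. The abscissa \<open>c\<close> is an explicit
  argument; any \<open>c > - min_j b j\<close> is admissible.
\<close>

definition meijer_G_n0_0n :: "real \<Rightarrow> nat \<Rightarrow> (nat \<Rightarrow> real) \<Rightarrow> real \<Rightarrow> complex" where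
  "meijer_G_n0_0n c n b x =
     1 / (2 * of_real pi * \<i>) *
     (LINT t | lborel.
        (\<Prod>j\<in>{1..n}. Gamma (of_real (b j) + Complex c t))
          * of_real x powr (- Complex c t) * \<i>)"

end

theory Submission
  imports Defs "HOL-Probability.Probability" "HOL-Real_Asymp.Real_Asymp"
begin

text \<open>
  Put \<open>b j = \<nu> j - \<nu> n\<close>. In logarithmic coordinates the weight and the Meijer function are both
  additive convolutions on the line, of the kernels \<open>exp (b j * t) * (1 + exp t / N) powr - (\<nu> j + N + 1)\<close>
  and \<open>exp (b j * t - exp t)\<close> respectively. Write \<open>G\<close> for the second convolution; the Mellin-Barnes
  integral is its Fourier inversion. The two are compared uniformly down to \<open>z = 0\<close>, where \<open>G\<close> may blow up.

  The key estimate is \<open>G (t - s) \<le> exp (\<kappa> * s) * G t\<close> for \<open>s \<ge> 0\<close> and \<open>t\<close> bounded above. It follows from a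
  bound on the mean of one variable \<open>u i\<close> under the gamma-type measure conditioned on the product
  \<open>u 1 * ... * u n = x\<close>: integration by parts trades a factor \<open>u j\<close> for \<open>u i\<close> at the cost of lower moments,
  so that the \<open>n\<close>-th moment of \<open>u i\<close> differs from the mean of the product, which is \<open>x\<close>, only by lower moments.

  Lower bound: \<open>ln (1 + y) \<le> y\<close> bounds each weight kernel below by a translate of the limit kernel,
  and the translation tends to 0. Upper bound: a power \<open>(1 + y) powr - q\<close> is a gamma mixture of
  exponentials, so the weight is the convolution of \<open>G\<close> with kernels that concentrate at 0, all of
  whose exponential moments tend to 1.
\<close>

section \<open>Convolution on the line\<close>

text \<open>As \<open>z\<close> approaches 0, \<open>t = ln ((cmod z)\<^sup>2)\<close> runs to
  -\<infinity>, where \<open>G\<close> may be unbounded. Pointwise or locally uniform convergence is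
  therefore not enough: a ratio has to be controlled on a whole half-line. The shift inequality for
  \<open>G\<close> removes \<open>t\<close> from the problem and leaves statements about the mixing
  kernels alone. The upper bound on \<open>t\<close> comes from compactness and is essential:
  already for exp (- exp t) the quotients of values at distance \<open>s\<close> are unbounded at
  +\<infinity>. The scaling by N^(n/2) is what permits the same variable s_j = ln (N |x_j|^2) in
  every factor: when the product of the x_j is z / N^(n/2), the s_j add up to \<open>t\<close>. Only
  integer shifts of the Gamma function enter, because the \<open>\<nu> j\<close> are integers and
  the growth rate \<kappa> is chosen natural; the recurrence then replaces Stirling's formula.
  Convolutions take values in \<open>ennreal\<close>, so that Tonelli and the algebra of convolution
  carry no integrability conditions.\<close>

definition conv :: "(real \<Rightarrow> ennreal) \<Rightarrow> (real \<Rightarrow> ennreal) \<Rightarrow> real \<Rightarrow> ennreal" where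
  "conv f g t = (\<integral>\<^sup>+ s. f s * g (t - s) \<partial>lborel)"

text \<open>The seed \<open>h\<close> is the factor of index \<open>n = m + 1\<close>, whose
  parameter \<open>b n\<close> is 0. Keeping it apart from the kernels lets power moments be placed
  on it while the kernels stay fixed.\<close>

primrec mconv :: "(nat \<Rightarrow> real \<Rightarrow> ennreal) \<Rightarrow> nat \<Rightarrow> (real \<Rightarrow> ennreal) \<Rightarrow> real \<Rightarrow> ennreal" where
  "mconv k 0 h = h"
| "mconv k (Suc m) h = conv (k (Suc m)) (mconv k m h)"

lemma measurable_conv [measurable]:
  assumes [measurable]: "f \<in> borel_measurable borel" "g \<in> borel_measurable borel"
  shows "conv f g \<in> borel_measurable borel"
  unfolding conv_def [abs_def] by measurable

lemma measurable_mconv [measurable (raw)]: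
  assumes [measurable]: "\<And>j. k j \<in> borel_measurable borel" "h \<in> borel_measurable borel"
  shows "mconv k m h \<in> borel_measurable borel"
  by (induction m) auto

lemma conv_commute:
  assumes [measurable]: "f \<in> borel_measurable borel" "g \<in> borel_measurable borel"
  shows "conv f g = conv g f"
proof
  fix t
  show "conv f g t = conv g f t"
    unfolding conv_def
    by (subst nn_integral_real_affine[where c = "-1" and t = t]) (auto simp: mult.commute)
qed

lemma conv_assoc:
  assumes [measurable]: "f \<in> borel_measurable borel" "g \<in> borel_measurable borel"
    "h \<in> borel_measurable borel"
  shows "conv (conv f g) h = conv f (conv g h)"
proof
  fix t
  have "conv (conv f g) h t = (\<integral>\<^sup>+ s. \<integral>\<^sup>+ r. f r * g (s - r) * h (t - s) \<partial>lborel \<partial>lborel)"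
    unfolding conv_def by (simp add: nn_integral_multc)
  also have "\<dots> = (\<integral>\<^sup>+ r. \<integral>\<^sup>+ s. f r * g (s - r) * h (t - s) \<partial>lborel \<partial>lborel)"
    by (rule lborel_pair.Fubini') measurable
  also have "\<dots> = (\<integral>\<^sup>+ r. f r * (\<integral>\<^sup>+ s. g s * h (t - r - s) \<partial>lborel) \<partial>lborel)"
  proof (intro nn_integral_cong)
    fix r
    have "(\<integral>\<^sup>+ s. f r * g (s - r) * h (t - s) \<partial>lborel)
        = f r * (\<integral>\<^sup>+ s. g (s - r) * h (t - s) \<partial>lborel)"
      by (simp add: nn_integral_cmult mult.assoc)
    also have "(\<integral>\<^sup>+ s. g (s - r) * h (t - s) \<partial>lborel) = (\<integral>\<^sup>+ s. g s * h (t - r - s) \<partial>lborel)"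
      by (subst nn_integral_real_affine[where c = 1 and t = r]) (auto simp: algebra_simps)
    finally show "(\<integral>\<^sup>+ s. f r * g (s - r) * h (t - s) \<partial>lborel)
        = f r * (\<integral>\<^sup>+ s. g s * h (t - r - s) \<partial>lborel)" .
  qed
  finally show "conv (conv f g) h t = conv f (conv g h) t" unfolding conv_def .
qed

lemma conv_left_commute:
  assumes [measurable]: "f \<in> borel_measurable borel" "g \<in> borel_measurable borel"
    "h \<in> borel_measurable borel"
  shows "conv f (conv g h) = conv g (conv f h)"
  using conv_assoc[of f g h] conv_assoc[of g f h] conv_commute[of f g] by simp

lemma conv_mono:
  assumes "\<And>s. f s \<le> f' s" "\<And>s. g s \<le> g' s"
  shows "conv f g t \<le> conv f' g' t"
  unfolding conv_def by (intro nn_integral_mono mult_mono assms) auto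

lemma conv_add_right:
  assumes [measurable]: "f \<in> borel_measurable borel" "g \<in> borel_measurable borel"
    "h \<in> borel_measurable borel"
  shows "conv f (\<lambda>t. g t + h t) = (\<lambda>t. conv f g t + conv f h t)"
  unfolding conv_def [abs_def] by (auto simp: distrib_left nn_integral_add)

lemma conv_cmult_right:
  assumes [measurable]: "f \<in> borel_measurable borel" "g \<in> borel_measurable borel"
  shows "conv f (\<lambda>t. c * g t) = (\<lambda>t. c * conv f g t)"
  unfolding conv_def [abs_def] by (auto simp: nn_integral_cmult[symmetric] ac_simps)

lemma conv_shift:
  assumes [measurable]: "f \<in> borel_measurable borel" "g \<in> borel_measurable borel"
  shows "conv (\<lambda>t. f (t + a)) (\<lambda>t. g (t + b)) t = conv f g (t + a + b)"
  unfolding conv_def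
  by (subst (2) nn_integral_real_affine[where c = 1 and t = a]) (auto simp: algebra_simps)

lemma mconv_mono:
  assumes "\<And>j s. j \<in> {1..m} \<Longrightarrow> k j s \<le> k' j s" "\<And>s. h s \<le> h' s"
  shows "mconv k m h t \<le> mconv k' m h' t"
  using assms(1) by (induction m arbitrary: t) (auto intro!: conv_mono assms(2))

lemma mconv_cong:
  assumes "\<And>j. j \<in> {1..m} \<Longrightarrow> k j = k' j"
  shows "mconv k m h = mconv k' m h"
  using assms by (induction m) auto

lemma mconv_add:
  assumes [measurable]: "\<And>j. k j \<in> borel_measurable borel"
    "g \<in> borel_measurable borel" "h \<in> borel_measurable borel"
  shows "mconv k m (\<lambda>t. g t + h t) = (\<lambda>t. mconv k m g t + mconv k m h t)"
  by (induction m) (auto simp: conv_add_right assms)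

lemma mconv_cmult:
  assumes [measurable]: "\<And>j. k j \<in> borel_measurable borel" "h \<in> borel_measurable borel"
  shows "mconv k m (\<lambda>t. c * h t) = (\<lambda>t. c * mconv k m h t)"
  by (induction m) (auto simp: conv_cmult_right)

lemma mconv_conv:
  assumes [measurable]: "\<And>j. k j \<in> borel_measurable borel"
    "f \<in> borel_measurable borel" "h \<in> borel_measurable borel"
  shows "mconv k m (conv f h) = conv f (mconv k m h)"
  by (induction m) (auto intro!: conv_left_commute)

lemma mconv_conv_kernels:
  assumes [measurable]: "\<And>j. f j \<in> borel_measurable borel" "\<And>j. g j \<in> borel_measurable borel"
    "h \<in> borel_measurable borel"
  shows "mconv (\<lambda>j. conv (g j) (f j)) m h = mconv g m (mconv f m h)"
  by (induction m) (auto simp: conv_assoc mconv_conv)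

text \<open>Each of the \<open>m\<close> kernels and the seed contributes one shift, hence
  \<open>Suc m\<close> of them.\<close>

lemma mconv_shift:
  assumes [measurable]: "\<And>j. k j \<in> borel_measurable borel" "h \<in> borel_measurable borel"
  shows "mconv (\<lambda>j s. k j (s + a)) m (\<lambda>s. h (s + a)) t = mconv k m h (t + real (Suc m) * a)"
proof (induction m arbitrary: t)
  case (Suc m)
  have "mconv (\<lambda>j s. k j (s + a)) m (\<lambda>s. h (s + a)) = (\<lambda>t. mconv k m h (t + real (Suc m) * a))"
    by (rule ext) (rule Suc.IH)
  then show ?case by (simp add: conv_shift algebra_simps)
qed simp

text \<open>Under Tonelli's theorem \<open>w t\<close> splits as \<open>w (s + (t - s))\<close>, so
  submultiplicativity separates the two factors. This reduces the weighted mass of the combined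
  mixing kernel to that of its constituents.\<close>

lemma conv_weighted_mass:
  assumes [measurable]: "f \<in> borel_measurable borel" "g \<in> borel_measurable borel"
    "w \<in> borel_measurable borel"
    and sub: "\<And>s r. w (s + r) \<le> w s * w r"
  shows "(\<integral>\<^sup>+ t. conv f g t * w t \<partial>lborel)
    \<le> (\<integral>\<^sup>+ t. f t * w t \<partial>lborel) * (\<integral>\<^sup>+ t. g t * w t \<partial>lborel)"
proof -
  have "(\<integral>\<^sup>+ t. conv f g t * w t \<partial>lborel)
      = (\<integral>\<^sup>+ t. \<integral>\<^sup>+ s. f s * g (t - s) * w t \<partial>lborel \<partial>lborel)"
    unfolding conv_def by (simp add: nn_integral_multc)
  also have "\<dots> = (\<integral>\<^sup>+ s. \<integral>\<^sup>+ t. f s * g (t - s) * w t \<partial>lborel \<partial>lborel)"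
    by (rule lborel_pair.Fubini') measurable
  also have "\<dots> = (\<integral>\<^sup>+ s. \<integral>\<^sup>+ t. f s * g t * w (s + t) \<partial>lborel \<partial>lborel)"
  proof (rule nn_integral_cong)
    fix s
    show "(\<integral>\<^sup>+ t. f s * g (t - s) * w t \<partial>lborel) = (\<integral>\<^sup>+ t. f s * g t * w (s + t) \<partial>lborel)"
      by (subst nn_integral_real_affine[where c = 1 and t = s]) auto
  qed
  also have "\<dots> \<le> (\<integral>\<^sup>+ s. \<integral>\<^sup>+ t. (f s * w s) * (g t * w t) \<partial>lborel \<partial>lborel)"
  proof (intro nn_integral_mono)
    fix s t
    have "f s * g t * w (s + t) \<le> f s * g t * (w s * w t)"
      by (intro mult_left_mono sub) auto
    then show "f s * g t * w (s + t) \<le> (f s * w s) * (g t * w t)" by (simp add: ac_simps)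
  qed
  also have "\<dots> = (\<integral>\<^sup>+ t. f t * w t \<partial>lborel) * (\<integral>\<^sup>+ t. g t * w t \<partial>lborel)"
    by (simp add: nn_integral_cmult nn_integral_multc)
  finally show ?thesis .
qed

lemma mconv_weighted_mass:
  assumes [measurable]: "\<And>j. k j \<in> borel_measurable borel" "h \<in> borel_measurable borel"
    "w \<in> borel_measurable borel"
    and sub: "\<And>s r. w (s + r) \<le> w s * w r"
  shows "(\<integral>\<^sup>+ t. mconv k m h t * w t \<partial>lborel)
    \<le> (\<Prod>j\<in>{1..m}. \<integral>\<^sup>+ t. k j t * w t \<partial>lborel) * (\<integral>\<^sup>+ t. h t * w t \<partial>lborel)"
proof (induction m)
  case (Suc m)
  have "(\<integral>\<^sup>+ t. mconv k (Suc m) h t * w t \<partial>lborel)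
      \<le> (\<integral>\<^sup>+ t. k (Suc m) t * w t \<partial>lborel) * (\<integral>\<^sup>+ t. mconv k m h t * w t \<partial>lborel)"
    by (simp, rule conv_weighted_mass[OF _ _ _ sub]) auto
  also have "\<dots> \<le> (\<integral>\<^sup>+ t. k (Suc m) t * w t \<partial>lborel) *
      ((\<Prod>j\<in>{1..m}. \<integral>\<^sup>+ t. k j t * w t \<partial>lborel) * (\<integral>\<^sup>+ t. h t * w t \<partial>lborel))"
    by (intro mult_left_mono Suc.IH) auto
  finally show ?case by (simp add: ac_simps prod.nat_ivl_Suc')
qed simp

text \<open>The substitution is made on compact intervals exhausting the half-line; continuity from
  below of the two density measures then passes to the union.\<close>

lemma nn_integral_exp_subst:
  fixes f :: "real \<Rightarrow> ennreal"
  assumes [measurable]: "f \<in> borel_measurable borel"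
  shows "(\<integral>\<^sup>+ x. f x * indicator {0<..} x \<partial>lborel) = (\<integral>\<^sup>+ t. f (exp t) * ennreal (exp t) \<partial>lborel)"
proof -
  \<comment> \<open>The offset 1 keeps the intervals nondegenerate at \<open>k = 0\<close>.\<close>
  define I where "I k = {exp (- real k - 1)..exp (real k + 1)}" for k :: nat
  define J where "J k = {- real k - 1..real k + 1}" for k :: nat
  have incI: "incseq I" and incJ: "incseq J" unfolding I_def J_def incseq_def by auto
  have UI: "(\<Union>k. I k) = {0<..}"
  proof (intro equalityI subsetI)
    fix x :: real assume "x \<in> {0<..}"
    obtain k :: nat where "\<bar>ln x\<bar> \<le> real k" using real_arch_simple by blast
    then have "exp (- real k - 1) \<le> exp (ln x)" "exp (ln x) \<le> exp (real k + 1)"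
      by (simp_all only: exp_le_cancel_iff)
    then have "x \<in> I k" using \<open>x \<in> {0<..}\<close> by (simp add: I_def del: exp_le_cancel_iff)
    then show "x \<in> (\<Union>k. I k)" by blast
  qed (auto simp: I_def intro: less_le_trans[OF exp_gt_zero])
  have UJ: "(\<Union>k. J k) = UNIV"
  proof (intro equalityI subsetI)
    fix x :: real
    obtain k :: nat where "\<bar>x\<bar> \<le> real k" using real_arch_simple by blast
    then have "x \<in> J k" by (auto simp: J_def)
    then show "x \<in> (\<Union>k. J k)" by blast
  qed auto
  have eq: "(\<integral>\<^sup>+ x. f x * indicator (I k) x \<partial>lborel)
      = (\<integral>\<^sup>+ t. f (exp t) * ennreal (exp t) * indicator (J k) t \<partial>lborel)" for k
    unfolding I_def J_def
    by (rule nn_integral_substitution_aux) (auto intro!: derivative_eq_intros continuous_intros)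
  have [measurable]: "I k \<in> sets borel" "J k \<in> sets borel" for k by (auto simp: I_def J_def)
  define M where "M = density lborel f"
  define M' where "M' = density lborel (\<lambda>t. f (exp t) * ennreal (exp t))"
  have "(\<integral>\<^sup>+ x. f x * indicator {0<..} x \<partial>lborel) = emeasure M (\<Union>k. I k)"
    unfolding M_def UI by (simp add: emeasure_density)
  also have "\<dots> = (SUP k. emeasure M (I k))"
    by (rule SUP_emeasure_incseq[symmetric]) (auto simp: incI M_def)
  also have "\<dots> = (SUP k. emeasure M' (J k))"
    using eq by (simp add: M_def M'_def emeasure_density)
  also have "\<dots> = emeasure M' (\<Union>k. J k)"
    by (rule SUP_emeasure_incseq) (auto simp: incJ M'_def)
  also have "\<dots> = (\<integral>\<^sup>+ t. f (exp t) * ennreal (exp t) \<partial>lborel)"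
    unfolding UJ M'_def by (simp add: emeasure_density)
  finally show ?thesis .
qed

section \<open>Log-gamma kernels\<close>

text \<open>This is \<open>u powr b * exp (- u)\<close> at \<open>u = exp t\<close>, the Gamma
  integrand in the variable \<open>ln u\<close>. For \<open>b \<le> 0\<close> it is not integrable
  at -\<infinity>; convolutions are still finite, because there the other factor is evaluated near
  +\<infinity>, where it decays doubly exponentially.\<close>

definition gker :: "real \<Rightarrow> real \<Rightarrow> ennreal" where
  "gker b t = ennreal (exp (b * t - exp t))"

lemma measurable_gker [measurable]: "gker b \<in> borel_measurable borel"
  unfolding gker_def [abs_def] by measurable

lemma gker_mass:
  assumes "p > 0"
  shows "(\<integral>\<^sup>+ t. gker p t \<partial>lborel) = ennreal (Gamma p)"
proof -
  have "ennreal (Gamma p) = (\<integral>\<^sup>+ x. ennreal (x powr (p - 1) / exp x) * indicator {0<..} x \<partial>lborel)"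
    unfolding Gamma_conv_nn_integral_real[OF assms]
    by (rule nn_integral_cong) (auto simp: indicator_def)
  also have "\<dots> = (\<integral>\<^sup>+ t. ennreal (exp t powr (p - 1) / exp (exp t)) * ennreal (exp t) \<partial>lborel)"
    by (rule nn_integral_exp_subst) auto
  also have "\<dots> = (\<integral>\<^sup>+ t. gker p t \<partial>lborel)"
    by (intro nn_integral_cong)
       (simp add: gker_def ennreal_mult'[symmetric] powr_def exp_diff exp_minus field_simps
          flip: exp_add)
  finally show ?thesis by simp
qed

text \<open>The substitution \<open>u = ln L - s\<close> absorbs the rate \<open>L\<close>.\<close>

lemma scaled_gker_mass:
  assumes "p > 0" "L > 0"
  shows "(\<integral>\<^sup>+ s. ennreal (exp (- p * s - L * exp (- s))) \<partial>lborel) = ennreal (L powr (- p) * Gamma p)"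
proof -
  have "(\<integral>\<^sup>+ s. ennreal (exp (- p * s - L * exp (- s))) \<partial>lborel)
      = (\<integral>\<^sup>+ u. ennreal (L powr (- p)) * gker p u \<partial>lborel)"
    using assms
    by (subst nn_integral_real_affine[where c = "-1" and t = "ln L"])
       (auto intro!: nn_integral_cong
          simp: gker_def ennreal_mult'[symmetric] powr_def exp_diff exp_minus exp_add field_simps)
  also have "\<dots> = ennreal (L powr (- p) * Gamma p)"
    using assms by (simp add: nn_integral_cmult gker_mass ennreal_mult' Gamma_real_pos less_imp_le)
  finally show ?thesis .
qed

section \<open>Exponential majorants and finiteness of the convolutions\<close>

lemma power_le_fact_exp:
  fixes y :: real
  assumes "y \<ge> 0"
  shows "y ^ n \<le> fact n * exp y"
proof -
  have "(\<Sum>k\<in>{n}. y ^ k /\<^sub>R fact k) \<le> exp y"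
    unfolding exp_def by (rule sum_le_suminf) (use assms summable_exp_generic[of y] in auto)
  then show ?thesis by (simp add: field_simps)
qed

lemma gker_le: "gker a s \<le> ennreal (fact n * exp (- (real n - a) * s))"
proof -
  have "exp (real n * s) \<le> fact n * exp (exp s)"
    using power_le_fact_exp[of "exp s" n] by (simp add: exp_of_nat_mult)
  then have "exp (a * s - real n * s - exp s) * exp (real n * s)
      \<le> exp (a * s - real n * s - exp s) * (fact n * exp (exp s))"
    by (rule mult_left_mono) simp
  then show ?thesis
    unfolding gker_def
    by (intro ennreal_leI) (simp add: algebra_simps flip: exp_add)
qed

text \<open>Exponentials are eigenfunctions of convolution: the factor \<open>exp (c * s)\<close>
  merges into the kernel and raises \<open>b\<close> to \<open>b + c\<close>, whose mass is the
  eigenvalue.\<close>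

lemma conv_gker_exp:
  assumes "b + c > 0" "C \<ge> 0"
  shows "conv (gker b) (\<lambda>t. ennreal (C * exp (- c * t))) t = ennreal (C * Gamma (b + c) * exp (- c * t))"
proof -
  have "conv (gker b) (\<lambda>t. ennreal (C * exp (- c * t))) t
      = (\<integral>\<^sup>+ s. ennreal (C * exp (- c * t)) * gker (b + c) s \<partial>lborel)"
    unfolding conv_def using assms
    by (intro nn_integral_cong)
       (auto simp: gker_def ennreal_mult'[symmetric] algebra_simps simp flip: exp_add)
  also have "\<dots> = ennreal (C * Gamma (b + c) * exp (- c * t))"
    using assms
    by (subst nn_integral_cmult) (auto simp: gker_mass ennreal_mult'[symmetric] ac_simps)
  finally show ?thesis .
qed

lemma mconv_gker_exp:
  assumes "\<And>j. j \<in> {1..m} \<Longrightarrow> b j + c > 0" "C \<ge> 0"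
  shows "mconv (\<lambda>j. gker (b j)) m (\<lambda>t. ennreal (C * exp (- c * t))) t
    = ennreal (C * (\<Prod>j\<in>{1..m}. Gamma (b j + c)) * exp (- c * t))"
  using assms(1)
proof (induction m arbitrary: t)
  case (Suc m)
  have *: "mconv (\<lambda>j. gker (b j)) m (\<lambda>t. ennreal (C * exp (- c * t)))
      = (\<lambda>t. ennreal (C * (\<Prod>j\<in>{1..m}. Gamma (b j + c)) * exp (- c * t)))"
    by (rule ext, rule Suc.IH) (use Suc.prems in auto)
  have "0 \<le> (\<Prod>j\<in>{1..m}. Gamma (b j + c))"
    using Suc.prems by (intro prod_nonneg) (auto intro!: less_imp_le Gamma_real_pos)
  then show ?case
    unfolding mconv.simps *
    by (subst conv_gker_exp) (use Suc.prems assms(2) in \<open>auto simp: prod.nat_ivl_Suc' ac_simps\<close>)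
qed simp

text \<open>The seed is dominated by an exponential of arbitrarily fast decay. Choosing the rate
  above all \<open>\<bar>b j\<bar>\<close> makes every eigenvalue \<open>Gamma (b j + c)\<close>
  finite and positive.\<close>

lemma mconv_gker_finite: "mconv (\<lambda>j. gker (b j)) m (gker a) t < \<infinity>"
proof -
  define B where "B = \<bar>a\<bar> + (\<Sum>j\<in>{1..m}. \<bar>b j\<bar>)"
  obtain n :: nat where n: "real n > B" using reals_Archimedean2 by blast
  have pos: "b j + (real n - a) > 0" if "j \<in> {1..m}" for j
  proof -
    have "\<bar>b j\<bar> \<le> (\<Sum>j\<in>{1..m}. \<bar>b j\<bar>)" using that by (intro member_le_sum) auto
    then show ?thesis using n unfolding B_def by linarith
  qed
  have "mconv (\<lambda>j. gker (b j)) m (gker a) t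
      \<le> mconv (\<lambda>j. gker (b j)) m (\<lambda>s. ennreal (fact n * exp (- (real n - a) * s))) t"
    by (rule mconv_mono) (rule order_refl, rule gker_le)
  also have "\<dots> < \<infinity>" by (subst mconv_gker_exp) (use pos in auto)
  finally show ?thesis .
qed

lemma conv_gker_finite: "conv (gker b) (gker a) t < \<infinity>"
  using mconv_gker_finite[of "\<lambda>_. b" 1 a t] by simp

text \<open>The difference of the two sides is the integral of the derivative of
  \<open>exp (b * s - exp s + a * (t - s) - exp (t - s))\<close> with respect to \<open>s\<close>.\<close>

lemma conv_gker_exchange:
  assumes "b \<le> a"
  shows "conv (gker b) (gker (a + 1)) t
    = conv (gker (b + 1)) (gker a) t + ennreal (a - b) * conv (gker b) (gker a) t"
proof -
  define E where "E s = exp (b * s - exp s + a * (t - s) - exp (t - s))" for s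
  have [measurable]: "E \<in> borel_measurable borel" unfolding E_def [abs_def] by measurable
  have Epos: "E s > 0" for s by (simp add: E_def)
  have c0: "conv (gker b) (gker a) t = (\<integral>\<^sup>+ s. ennreal (E s) \<partial>lborel)"
    and c1: "conv (gker b) (gker (a + 1)) t = (\<integral>\<^sup>+ s. ennreal (E s * exp (t - s)) \<partial>lborel)"
    and c2: "conv (gker (b + 1)) (gker a) t = (\<integral>\<^sup>+ s. ennreal (E s * exp s) \<partial>lborel)"
    unfolding conv_def gker_def E_def
    by (auto intro!: nn_integral_cong simp: ennreal_mult'[symmetric] algebra_simps simp flip: exp_add)
  have i0: "integrable lborel E"
    using conv_gker_finite[of b a t] Epos unfolding c0
    by (intro integrableI_nonneg) (auto simp: less_imp_le top.not_eq_extremum)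
  have i1: "integrable lborel (\<lambda>s. E s * exp (t - s))"
    using conv_gker_finite[of b "a + 1" t] Epos unfolding c1
    by (intro integrableI_nonneg) (auto simp: less_imp_le top.not_eq_extremum)
  have i2: "integrable lborel (\<lambda>s. E s * exp s)"
    using conv_gker_finite[of "b + 1" a t] Epos unfolding c2
    by (intro integrableI_nonneg) (auto simp: less_imp_le top.not_eq_extremum)
  define D where "D s = E s * exp (t - s) - E s * exp s - (a - b) * E s" for s
  have iD: "integrable lborel D"
    unfolding D_def using i0 i1 i2 by auto
  \<comment> \<open>\<open>D\<close> is the derivative of \<open>E\<close>. The boundary terms
    vanish because of exp (- exp (t - s)) at -\<infinity> and of exp (- exp s) at
    +\<infinity>.\<close>
  have "(LBINT s=-\<infinity>..\<infinity>. D s) = 0 - 0"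
  proof (rule interval_integral_FTC_integrable[where F = E])
    show "(E has_vector_derivative D s) (at s)" for s
      unfolding E_def D_def has_real_derivative_iff_has_vector_derivative[symmetric]
      by (auto intro!: derivative_eq_intros simp: algebra_simps)
    show "isCont D s" for s unfolding D_def E_def by (intro continuous_intros)
    show "set_integrable lborel (einterval (-\<infinity>) \<infinity>) D"
      using iD by (simp add: set_integrable_def)
    have "(E \<longlongrightarrow> 0) at_bot" unfolding E_def by real_asymp
    then show "((E \<circ> real_of_ereal) \<longlongrightarrow> 0) (at_right (- \<infinity>))"
      by (simp add: ereal_tendsto_simps)
    have "(E \<longlongrightarrow> 0) at_top" unfolding E_def by real_asymp
    then show "((E \<circ> real_of_ereal) \<longlongrightarrow> 0) (at_left \<infinity>)"
      by (simp add: ereal_tendsto_simps)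
  qed simp
  then have "(LINT s|lborel. D s) = 0"
    by (simp add: interval_lebesgue_integral_def set_lebesgue_integral_def)
  then have "(LINT s|lborel. E s * exp (t - s))
      = (LINT s|lborel. E s * exp s) + (a - b) * (LINT s|lborel. E s)"
    unfolding D_def using i0 i1 i2 by simp
  moreover have "(\<integral>\<^sup>+ s. ennreal (E s) \<partial>lborel) = ennreal (LINT s|lborel. E s)"
    using i0 Epos by (intro nn_integral_eq_integral) (auto simp: less_imp_le)
  moreover have "(\<integral>\<^sup>+ s. ennreal (E s * exp (t - s)) \<partial>lborel) = ennreal (LINT s|lborel. E s * exp (t - s))"
    using i1 Epos by (intro nn_integral_eq_integral) (auto simp: less_imp_le)
  moreover have "(\<integral>\<^sup>+ s. ennreal (E s * exp s) \<partial>lborel) = ennreal (LINT s|lborel. E s * exp s)"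
    using i2 Epos by (intro nn_integral_eq_integral) (auto simp: less_imp_le)
  moreover have "(LINT s|lborel. E s) \<ge> 0" "(LINT s|lborel. E s * exp s) \<ge> 0"
    using Epos by (auto intro!: integral_nonneg_AE simp: less_imp_le)
  ultimately show ?thesis unfolding c0 c1 c2
    \<comment> \<open>The hypothesis \<open>b \<le> a\<close> keeps \<open>ennreal (a - b)\<close>
      from being truncated to 0.\<close>
    using assms by (simp add: ennreal_mult'[symmetric] ennreal_plus[symmetric] del: ennreal_plus)
qed

section \<open>Moments and growth of the limit function\<close>

text \<open>An inequality between one kernel and the seed survives convolution with all the others.
  If \<open>i\<close> is the outermost index, its kernel commutes inward to the seed; otherwise the
  outer kernel is applied to the induction hypothesis.\<close>

lemma mconv_exchange:
  assumes [measurable]: "\<And>j. k j \<in> borel_measurable borel"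
    "f \<in> borel_measurable borel" "f' \<in> borel_measurable borel" "f'' \<in> borel_measurable borel"
    "h \<in> borel_measurable borel" "h' \<in> borel_measurable borel" "h'' \<in> borel_measurable borel"
  assumes i: "i \<in> {1..m}"
    and le: "\<And>t. conv f h t \<le> conv f' h' t + d * conv f'' h'' t"
  shows "mconv (k(i := f)) m h t \<le> mconv (k(i := f')) m h' t + d * mconv (k(i := f'')) m h'' t"
  using i
proof (induction m arbitrary: t)
  case (Suc m)
  have meas [measurable]: "(k(i := g)) j \<in> borel_measurable borel"
    if [measurable]: "g \<in> borel_measurable borel" for g j by simp
  show ?case
  proof (cases "i = Suc m")
    case True
    have eq: "mconv (k(i := g)) (Suc m) u = mconv k m (conv g u)"
      if [measurable]: "g \<in> borel_measurable borel" "u \<in> borel_measurable borel" for g u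
    proof -
      have "mconv (k(i := g)) m u = mconv k m u"
        by (rule mconv_cong) (use True in auto)
      then show ?thesis using True by (simp add: mconv_conv)
    qed
    have "mconv k m (conv f h) t \<le> mconv k m (\<lambda>t. conv f' h' t + d * conv f'' h'' t) t"
      by (rule mconv_mono) (auto intro: le)
    also have "\<dots> = mconv k m (conv f' h') t + d * mconv k m (conv f'' h'') t"
      by (simp add: mconv_add mconv_cmult)
    finally show ?thesis by (simp only: eq assms(2-7))
  next
    case False
    then have "i \<in> {1..m}" using Suc.prems by auto
    note IH = Suc.IH[OF this]
    have "conv (k (Suc m)) (mconv (k(i := f)) m h) t
       \<le> conv (k (Suc m)) (\<lambda>t. mconv (k(i := f')) m h' t + d * mconv (k(i := f'')) m h'' t) t"
      by (rule conv_mono) (auto intro: IH)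
    also have "\<dots> = conv (k (Suc m)) (mconv (k(i := f')) m h') t
        + d * conv (k (Suc m)) (mconv (k(i := f'')) m h'') t"
      by (subst conv_add_right) (auto simp: conv_cmult_right intro!: measurable_mconv meas)
    finally show ?thesis using False by (simp only: mconv.simps fun_upd_other[OF False[symmetric]])
  qed
qed simp

text \<open>The arguments of the factors add up to \<open>t\<close>, so the weights
  \<open>exp s\<close> multiply to the constant \<open>exp t\<close>. In the variables
  \<open>u = exp s\<close> this says that the product of all of them is fixed.\<close>

lemma mconv_exp_weight:
  assumes [measurable]: "\<And>j. k j \<in> borel_measurable borel" "h \<in> borel_measurable borel"
  shows "mconv (\<lambda>j s. ennreal (exp s) * k j s) m (\<lambda>s. ennreal (exp s) * h s) t
    = ennreal (exp t) * mconv k m h t"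
proof (induction m arbitrary: t)
  case (Suc m)
  have *: "mconv (\<lambda>j s. ennreal (exp s) * k j s) m (\<lambda>s. ennreal (exp s) * h s)
      = (\<lambda>t. ennreal (exp t) * mconv k m h t)"
    by (rule ext) (rule Suc.IH)
  have "ennreal (exp s) * k (Suc m) s * (ennreal (exp (t - s)) * mconv k m h (t - s))
      = ennreal (exp t) * (k (Suc m) s * mconv k m h (t - s))" for s
  proof -
    have "ennreal (exp s) * k (Suc m) s * (ennreal (exp (t - s)) * mconv k m h (t - s))
       = (ennreal (exp s) * ennreal (exp (t - s))) * (k (Suc m) s * mconv k m h (t - s))"
      by (simp only: ac_simps)
    also have "ennreal (exp s) * ennreal (exp (t - s)) = ennreal (exp t)"
      by (simp add: ennreal_mult'[symmetric] flip: exp_add)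
    finally show ?thesis .
  qed
  moreover have [measurable]: "mconv k m h \<in> borel_measurable borel" by measurable
  ultimately show ?case
    by (simp only: mconv.simps * conv_def) (rule nn_integral_cmult, measurable)
qed simp

lemma gker_add_1: "gker (b + 1) s = ennreal (exp s) * gker b s"
  by (simp add: gker_def ennreal_mult'[symmetric] algebra_simps flip: exp_add)

lemma ennreal_linear:
  assumes "a \<ge> 0" "b \<ge> 0" "x \<ge> 0" "y \<ge> 0"
  shows "ennreal a * ennreal x + ennreal b * ennreal y = ennreal (a * x + b * y)"
  using assms by (simp add: ennreal_mult)

text \<open>With \<open>u = exp s\<close> the two cases are \<open>u \<ge> 2 * c\<close>, where the
  top power dominates, and \<open>u < 2 * c\<close>, where \<open>u ^ m\<close> is bounded. The
  coefficient 1/2 leaves room to absorb the top moment into the side it came from.\<close>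

lemma gker_moment_interpolation:
  assumes "c \<ge> 0"
  shows "ennreal c * gker (real m) s
    \<le> ennreal (1/2) * gker (real m + 1) s + ennreal (c * (2 * c) ^ m) * gker 0 s"
proof -
  define u where "u = exp s"
  have u: "u > 0" by (simp add: u_def)
  have "c * u ^ m \<le> 1/2 * u ^ Suc m + c * (2 * c) ^ m"
  proof (cases "u \<ge> 2 * c")
    case True
    then have "c * u ^ m \<le> (u / 2) * u ^ m" using u by (intro mult_right_mono) auto
    also have "\<dots> \<le> 1/2 * u ^ Suc m + c * (2 * c) ^ m" using assms by simp
    finally show ?thesis .
  next
    case False
    then have "c * u ^ m \<le> c * (2 * c) ^ m"
      using u assms by (intro mult_left_mono power_mono) auto
    also have "\<dots> \<le> 1/2 * u ^ Suc m + c * (2 * c) ^ m" using u by simp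
    finally show ?thesis .
  qed
  then have "(c * u ^ m) * exp (- u) \<le> (1/2 * u ^ Suc m + c * (2 * c) ^ m) * exp (- u)"
    by (rule mult_right_mono) simp
  moreover have "exp (real k * s - exp s) = u ^ k * exp (- u)" for k
    by (simp add: u_def exp_of_nat_mult[symmetric] flip: exp_add)
  from this[of m] this[of "Suc m"] this[of 0]
  have "exp (real m * s - exp s) = u ^ m * exp (- u)"
    "exp ((real m + 1) * s - exp s) = u ^ Suc m * exp (- u)" "exp (0 * s - exp s) = exp (- u)"
    by (simp_all add: add.commute)
  ultimately have "c * exp (real m * s - exp s)
      \<le> 1/2 * exp ((real m + 1) * s - exp s) + c * (2 * c) ^ m * exp (0 * s - exp s)"
    by (simp only:) (simp add: algebra_simps)
  then show ?thesis
    unfolding gker_def using assms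
    by (subst ennreal_linear) (auto simp only: ennreal_mult[symmetric] exp_ge_zero
      intro!: ennreal_leI mult_nonneg_nonneg zero_le_power)
qed

lemma gker_1_le: "gker 1 s \<le> gker 0 s + gker (real m + 1) s"
proof -
  define u where "u = exp s"
  have u: "u > 0" by (simp add: u_def)
  have "u \<le> 1 + u ^ Suc m"
  proof (cases "u \<le> 1")
    case False
    then have "u ^ 1 \<le> u ^ Suc m" by (intro power_increasing) auto
    then show ?thesis by simp
  qed (use u in \<open>simp add: add_increasing2\<close>)
  then have "u * exp (- u) \<le> (1 + u ^ Suc m) * exp (- u)"
    by (rule mult_right_mono) simp
  moreover have "exp (real k * s - exp s) = u ^ k * exp (- u)" for k
    by (simp add: u_def exp_of_nat_mult[symmetric] flip: exp_add)
  from this[of 1] this[of "Suc m"] this[of 0]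
  have "exp (1 * s - exp s) = u * exp (- u)"
    "exp ((real m + 1) * s - exp s) = u ^ Suc m * exp (- u)" "exp (0 * s - exp s) = exp (- u)"
    by (simp_all add: add.commute)
  ultimately have "exp (1 * s - exp s) \<le> exp (0 * s - exp s) + exp ((real m + 1) * s - exp s)"
    by (simp only:) (simp add: algebra_simps)
  then show ?thesis
    unfolding gker_def
    by (subst ennreal_plus[symmetric]) (auto simp only: exp_ge_zero intro!: ennreal_leI)
qed

lemma mconv_gker_moment:
  assumes b: "\<And>j. j \<in> {1..m} \<Longrightarrow> b j \<le> 0"
  obtains \<kappa> :: nat where
    "\<And>t. t \<le> T \<Longrightarrow> mconv (\<lambda>j. gker (b j)) m (gker 1) t \<le> of_nat \<kappa> * mconv (\<lambda>j. gker (b j)) m (gker 0) t"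
proof -
  \<comment> \<open>\<open>K i\<close> has its first \<open>i\<close> parameters raised by one, and
    \<open>X i k\<close> carries the power \<open>k\<close> on the seed variable. One exchange moves
    one unit of exponent between the seed and a kernel.\<close>
  define K where "K i = (\<lambda>j. gker (if j \<le> i then b j + 1 else b j))" for i
  define X where "X i k = mconv (K i) m (gker (real k))" for i k
  \<comment> \<open>Up to lower moments \<open>X 0 (m + 1)\<close> agrees with \<open>X m 1\<close>, in which all parameters are raised by one,
    so that it is \<open>exp t\<close> times the original function.\<close>
  define D where "D = real m + (\<Sum>j\<in>{1..m}. \<bar>b j\<bar>)"
  have D: "real k - b j \<le> D" if "j \<in> {1..m}" "k \<le> m" for j k
  proof -
    have "\<bar>b j\<bar> \<le> (\<Sum>j\<in>{1..m}. \<bar>b j\<bar>)" using that by (intro member_le_sum) auto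
    then show ?thesis using that unfolding D_def by linarith
  qed
  have D0: "D \<ge> 0" unfolding D_def by (auto intro!: add_nonneg_nonneg sum_nonneg)
  have [measurable]: "K i j \<in> borel_measurable borel" for i j by (simp add: K_def)
  have K1: "K (Suc i) = (K i)(Suc i := gker (b (Suc i) + 1))" for i
    by (auto simp: K_def fun_eq_iff)
  have K0: "K i = (K i)(Suc i := gker (b (Suc i)))" for i
    by (auto simp: K_def fun_eq_iff)
  have ex: "conv (gker (b j)) (gker (real k + 1)) t
      = conv (gker (b j + 1)) (gker (real k)) t
        + ennreal (real k - b j) * conv (gker (b j)) (gker (real k)) t" if "j \<in> {1..m}" for j k t
    using b[OF that] by (intro conv_gker_exchange) simp
  have lower: "X (Suc i) k t \<le> X i (Suc k) t" if i: "Suc i \<in> {1..m}" for i k t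
  proof -
    \<comment> \<open>The remainder in the exchange identity is nonnegative and is dropped; the term
      with factor 0 only supplies the shape required by \<open>mconv_exchange\<close>.\<close>
    have "X (Suc i) k t \<le> X i (Suc k) t + 0 * X i (Suc k) t"
      unfolding X_def K1 by (subst (2 3) K0, rule mconv_exchange)
        (use i in \<open>auto simp: ex[OF i] add.commute[of 1]\<close>)
    then show ?thesis by simp
  qed
  have upper: "X i (Suc k) t \<le> X (Suc i) k t + ennreal D * X i k t"
    if i: "Suc i \<in> {1..m}" and k: "k \<le> m" for i k t
    unfolding X_def K1
  proof (subst (1 3) K0, rule mconv_exchange)
    show "conv (gker (b (Suc i))) (gker (real (Suc k))) t
        \<le> conv (gker (b (Suc i) + 1)) (gker (real k)) t
          + ennreal D * conv (gker (b (Suc i))) (gker (real k)) t" for t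
      using ex[OF i, of k t] D[OF i k]
      by (auto simp: add.commute[of 1] intro!: add_left_mono mult_right_mono ennreal_leI)
  qed (use i in auto)
  have low0: "X i k t \<le> X 0 (i + k) t" if "i \<le> m" for i k t
    using that
  proof (induction i arbitrary: k)
    case (Suc i)
    have "X (Suc i) k t \<le> X i (Suc k) t" by (rule lower) (use Suc.prems in auto)
    also have "\<dots> \<le> X 0 (i + Suc k) t" by (rule Suc.IH) (use Suc.prems in auto)
    finally show ?case by simp
  qed simp
  \<comment> \<open>Each exchange leaves a remainder \<open>X i (m - i)\<close> of total degree
    \<open>m\<close>, which \<open>low0\<close> returns to \<open>X 0 m\<close>. Hence
    \<open>i\<close> exchanges cost \<open>real i * D\<close> in all, and \<open>i = m\<close>
    reaches \<open>X m 1\<close>.\<close>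
  have up: "X 0 (Suc m) t \<le> X i (Suc m - i) t + ennreal (real i * D) * X 0 m t" if "i \<le> m" for i t
    using that
  proof (induction i)
    case (Suc i)
    have "X 0 (Suc m) t \<le> X i (Suc (m - i)) t + ennreal (real i * D) * X 0 m t"
      using Suc by (simp add: Suc_diff_le)
    also have "X i (Suc (m - i)) t \<le> X (Suc i) (m - i) t + ennreal D * X i (m - i) t"
      using Suc.prems by (intro upper) auto
    also have "X i (m - i) t \<le> X 0 m t" using low0[of i "m - i" t] Suc.prems by simp
    finally have "X 0 (Suc m) t
        \<le> X (Suc i) (m - i) t + (ennreal D * X 0 m t + ennreal (real i * D) * X 0 m t)"
      by (simp add: add_mono mult_left_mono add.assoc)
    also have "ennreal D * X 0 m t + ennreal (real i * D) * X 0 m t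
        = ennreal (real (Suc i) * D) * X 0 m t"
      using D0 by (simp add: distrib_right[symmetric] ennreal_plus[symmetric] del: ennreal_plus)
        (simp add: algebra_simps)
    finally show ?case by simp
  qed simp
  define F where "F t = mconv (\<lambda>j. gker (b j)) m (gker 0) t" for t
  have F: "X 0 0 t = F t" for t
    unfolding F_def X_def by (simp, rule fun_cong[OF mconv_cong]) (auto simp: K_def)
  have Xm: "X m 1 t = ennreal (exp t) * F t" for t
  proof -
    have g: "gker 1 = (\<lambda>s. ennreal (exp s) * gker 0 s)" using gker_add_1[of 0] by auto
    have "X m 1 t = mconv (\<lambda>j s. ennreal (exp s) * gker (b j) s) m (gker 1) t"
      unfolding X_def
      by (simp, rule fun_cong[OF mconv_cong]) (auto simp: K_def gker_add_1 fun_eq_iff)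
    also have "\<dots> = ennreal (exp t) * F t"
      unfolding F_def g by (rule mconv_exp_weight) auto
    finally show ?thesis .
  qed
  have fin: "X i k t < \<infinity>" for i k t unfolding X_def K_def by (rule mconv_gker_finite)
  define c where "c = real m * D"
  define C where "C = c * (2 * c) ^ m"
  have c0: "c \<ge> 0" and C0: "C \<ge> 0" using D0 by (auto simp: c_def C_def)
  \<comment> \<open>With \<open>a = X 0 (Suc m) t\<close> and \<open>f = F t\<close>, the estimate
    below is \<open>a \<le> exp T * f + a / 2 + C * f\<close>. Solving it for \<open>a + f\<close>
    gives this constant.\<close>
  obtain \<kappa> :: nat where \<kappa>: "1 + 2 * (exp T + C) \<le> real \<kappa>" using real_arch_simple by blast
  have "mconv (\<lambda>j. gker (b j)) m (gker 1) t \<le> of_nat \<kappa> * F t" if t: "t \<le> T" for t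
  proof -
    have cm: "ennreal c * X 0 m t \<le> ennreal (1/2) * X 0 (Suc m) t + ennreal C * X 0 0 t"
    proof -
      have "ennreal c * X 0 m t = mconv (K 0) m (\<lambda>s. ennreal c * gker (real m) s) t"
        unfolding X_def by (simp add: mconv_cmult)
      also have "\<dots> \<le> mconv (K 0) m (\<lambda>s. ennreal (1/2) * gker (real m + 1) s + ennreal C * gker 0 s) t"
        unfolding C_def by (intro mconv_mono gker_moment_interpolation c0 order_refl)
      also have "\<dots> = ennreal (1/2) * X 0 (Suc m) t + ennreal C * X 0 0 t"
        unfolding X_def by (simp add: mconv_add mconv_cmult add.commute[of 1])
      finally show ?thesis .
    qed
    have "X 0 (Suc m) t \<le> X m 1 t + ennreal c * X 0 m t"
      using up[of m t] by (simp add: c_def)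
    also have "\<dots> \<le> ennreal (exp T) * F t + (ennreal (1/2) * X 0 (Suc m) t + ennreal C * F t)"
      using cm t unfolding Xm F by (intro add_mono mult_right_mono) (auto intro!: ennreal_leI)
    finally have main: "X 0 (Suc m) t
        \<le> ennreal (exp T) * F t + (ennreal (1/2) * X 0 (Suc m) t + ennreal C * F t)" .
    \<comment> \<open>Finiteness of the top moment is what permits subtracting half of it from both
      sides.\<close>
    obtain a where a: "X 0 (Suc m) t = ennreal a" "a \<ge> 0"
      using fin[of 0 "Suc m" t] by (cases "X 0 (Suc m) t") auto
    obtain f where f: "F t = ennreal f" "f \<ge> 0"
      using fin[of 0 0 t] F by (cases "F t") auto
    have "a \<le> exp T * f + (1/2 * a + C * f)"
    proof -
      have "ennreal a \<le> ennreal (exp T * f) + ennreal (1/2 * a + C * f)"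
        using main a f C0 by (simp only: ennreal_linear) (simp add: ennreal_mult')
      also have "\<dots> = ennreal (exp T * f + (1/2 * a + C * f))"
        using a f C0 by (intro ennreal_plus[symmetric]) auto
      finally show ?thesis using a f C0 by (subst (asm) ennreal_le_iff) auto
    qed
    then have "a + f \<le> (1 + 2 * (exp T + C)) * f" by (simp add: algebra_simps)
    also have "\<dots> \<le> real \<kappa> * f" using \<kappa> f by (intro mult_right_mono) auto
    finally have af: "a + f \<le> real \<kappa> * f" .
    have "mconv (\<lambda>j. gker (b j)) m (gker 1) t
        \<le> mconv (\<lambda>j. gker (b j)) m (\<lambda>s. gker 0 s + gker (real m + 1) s) t"
      by (intro mconv_mono gker_1_le order_refl)
    also have "\<dots> = F t + mconv (\<lambda>j. gker (b j)) m (gker (real m + 1)) t"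
      unfolding F_def by (simp add: mconv_add)
    also have "mconv (\<lambda>j. gker (b j)) m (gker (real m + 1)) t = X 0 (Suc m) t"
      unfolding X_def by (simp add: add.commute[of 1], rule fun_cong[OF mconv_cong]) (auto simp: K_def)
    also have "F t + X 0 (Suc m) t \<le> of_nat \<kappa> * F t"
      using af a f by (simp add: ennreal_mult'[symmetric] ennreal_plus[symmetric] add.commute
        ennreal_of_nat_eq_real_of_nat del: ennreal_plus)
    finally show ?thesis .
  qed
  then show ?thesis using that unfolding F_def by blast
qed

section \<open>The limit function: positivity, monotonicity and growth to the left\<close>

definition Gfun :: "nat \<Rightarrow> (nat \<Rightarrow> real) \<Rightarrow> real \<Rightarrow> real" where
  "Gfun m b t = enn2real (mconv (\<lambda>j. gker (b j)) m (gker 0) t)"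

lemma ennreal_Gfun: "ennreal (Gfun m b t) = mconv (\<lambda>j. gker (b j)) m (gker 0) t"
  unfolding Gfun_def using mconv_gker_finite[of b m 0 t] by (simp add: ennreal_enn2real_if)

lemma conv_pos:
  assumes [measurable]: "f \<in> borel_measurable borel" "g \<in> borel_measurable borel"
    and "\<And>s. f s > 0" "\<And>s. g s > 0"
  shows "conv f g t > 0"
proof -
  have "\<not> (AE s in lborel. f s * g (t - s) = 0)"
  proof
    assume "AE s in lborel. f s * g (t - s) = 0"
    then have "AE s::real in lborel. False"
      using assms(3,4) by (auto elim!: eventually_mono simp: less_le)
    then show False
      by (simp only: eventually_False ae_filter_eq_bot_iff) simp
  qed
  then have "conv f g t \<noteq> 0" unfolding conv_def by (subst nn_integral_0_iff_AE) auto
  then show ?thesis by (simp add: zero_less_iff_neq_zero)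
qed

lemma Gfun_pos: "Gfun m b t > 0"
proof -
  have "mconv (\<lambda>j. gker (b j)) m (gker 0) t > 0"
    by (induction m arbitrary: t) (auto intro!: conv_pos measurable_mconv simp: gker_def)
  then show ?thesis using ennreal_Gfun[of m b t] by (metis ennreal_less_zero_iff ennreal_0 ennreal_eq_0_iff leI order_less_irrefl)
qed

text \<open>The seed has parameter 0, so it is the decreasing function exp (- exp t), and
  convolution with nonnegative kernels preserves monotonicity.\<close>

lemma Gfun_antimono:
  assumes "s \<le> t"
  shows "Gfun m b t \<le> Gfun m b s"
proof -
  define d where "d = t - s"
  have "mconv (\<lambda>j. gker (b j)) m (gker 0) (s + d) \<le> mconv (\<lambda>j. gker (b j)) m (gker 0) s"
  proof (induction m arbitrary: s)
    case 0
    then show ?case using assms by (auto simp: gker_def d_def intro!: ennreal_leI)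
  next
    case (Suc m)
    have "mconv (\<lambda>j. gker (b j)) m (gker 0) (s + d - r) \<le> mconv (\<lambda>j. gker (b j)) m (gker 0) (s - r)"
      for r using Suc[of "s - r"] by (simp add: algebra_simps)
    then show ?case unfolding mconv.simps conv_def
      by (intro nn_integral_mono mult_left_mono) auto
  qed
  then have "ennreal (Gfun m b t) \<le> ennreal (Gfun m b s)" by (simp add: ennreal_Gfun d_def)
  then show ?thesis using Gfun_pos by (simp add: less_imp_le)
qed

text \<open>This is a Gronwall argument without derivatives: the moment bound controls the increment
  over a short step by \<kappa> times the value, and \<open>s\<close> is divided into
  \<open>k\<close> equal steps with \<open>k\<close> tending to \<infinity>.\<close>

lemma Gfun_doubling:
  assumes b: "\<And>j. j \<in> {1..m} \<Longrightarrow> b j \<le> 0"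
  obtains \<kappa> :: nat where
    "\<And>s t. 0 \<le> s \<Longrightarrow> t \<le> T \<Longrightarrow> Gfun m b (t - s) \<le> exp (real \<kappa> * s) * Gfun m b t"
proof -
  obtain \<kappa> :: nat where \<kappa>: "\<And>t. t \<le> T \<Longrightarrow>
      mconv (\<lambda>j. gker (b j)) m (gker 1) t \<le> of_nat \<kappa> * mconv (\<lambda>j. gker (b j)) m (gker 0) t"
    using mconv_gker_moment[of m b T] b by blast
  have step: "Gfun m b (t - s) * (1 - real \<kappa> * (exp s - 1)) \<le> Gfun m b t"
    if s: "0 \<le> s" and t: "t \<le> T" for s t
  proof -
    define \<delta> where "\<delta> = exp s - 1"
    have \<delta>: "\<delta> \<ge> 0" using s by (simp add: \<delta>_def)
    \<comment> \<open>The tangent inequality for the exponential: shifting the seed by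
      \<open>s\<close> multiplies \<open>u = exp r\<close> by \<open>1 + \<delta>\<close> and lowers
      \<open>exp (- u)\<close> by at most \<open>\<delta> * u * exp (- u)\<close>, which is a
      multiple of \<open>gker 1\<close>.\<close>
    have pt: "gker 0 r \<le> gker 0 (r + s) + ennreal \<delta> * gker 1 r" for r
    proof -
      have "1 + (- exp r * \<delta>) \<le> exp (- exp r * \<delta>)" by (rule exp_ge_add_one_self)
      then have "exp (- exp r) * (1 + (- exp r * \<delta>)) \<le> exp (- exp r) * exp (- exp r * \<delta>)"
        by (rule mult_left_mono) simp
      moreover have "exp (- exp r) * exp (- exp r * \<delta>) = exp (- exp (r + s))"
        by (simp add: \<delta>_def algebra_simps exp_add[symmetric])
      moreover have "exp (- exp r) * exp r = exp (1 * r - exp r)"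
        by (simp flip: exp_add)
      ultimately have "exp (- exp r) \<le> exp (- exp (r + s)) + \<delta> * exp (1 * r - exp r)"
        by (simp add: algebra_simps)
      then show ?thesis unfolding gker_def using \<delta>
        by (simp add: ennreal_mult'[symmetric] ennreal_plus[symmetric] del: ennreal_plus)
    qed
    have shift: "mconv (\<lambda>j. gker (b j)) m (\<lambda>r. gker 0 (r + s)) r
        = mconv (\<lambda>j. gker (b j)) m (gker 0) (r + s)" for r
    proof (induction m arbitrary: r)
      case (Suc m)
      show ?case by (simp add: conv_def Suc algebra_simps)
    qed simp
    have "ennreal (Gfun m b (t - s)) \<le>
        mconv (\<lambda>j. gker (b j)) m (\<lambda>r. gker 0 (r + s) + ennreal \<delta> * gker 1 r) (t - s)"
      unfolding ennreal_Gfun by (intro mconv_mono pt order_refl)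
    also have "\<dots> = ennreal (Gfun m b t) + ennreal \<delta> * mconv (\<lambda>j. gker (b j)) m (gker 1) (t - s)"
      by (simp add: mconv_add mconv_cmult shift ennreal_Gfun)
    also have "\<dots> \<le> ennreal (Gfun m b t) + ennreal \<delta> * (of_nat \<kappa> * ennreal (Gfun m b (t - s)))"
      unfolding ennreal_Gfun using s t by (intro add_left_mono mult_left_mono \<kappa>) auto
    also have "\<dots> = ennreal (Gfun m b t + \<delta> * (real \<kappa> * Gfun m b (t - s)))"
      using \<delta> Gfun_pos[of m b]
      by (simp add: ennreal_of_nat_eq_real_of_nat ennreal_mult'[symmetric] less_imp_le)
    finally have "Gfun m b (t - s) \<le> Gfun m b t + \<delta> * (real \<kappa> * Gfun m b (t - s))"
      using \<delta> Gfun_pos[of m b] by (subst (asm) ennreal_le_iff) (auto intro!: add_nonneg_nonneg simp: less_imp_le)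
    then show ?thesis by (simp add: \<delta>_def algebra_simps)
  qed
  have "Gfun m b (t - s) \<le> exp (real \<kappa> * s) * Gfun m b t" if s: "0 \<le> s" and t: "t \<le> T" for s t
  proof -
    have lim: "(\<lambda>k. (1 - real \<kappa> * (exp (s / real k) - 1)) ^ k) \<longlonglongrightarrow> exp (- (real \<kappa> * s))"
      by real_asymp
    have "(\<lambda>k. 1 - real \<kappa> * (exp (s / real k) - 1)) \<longlonglongrightarrow> 1" by real_asymp
    \<comment> \<open>Once the one-step factor is positive, the one-step inequality may be
      multiplied by its powers and thus iterated.\<close>
    then have "eventually (\<lambda>k. 1 - real \<kappa> * (exp (s / real k) - 1) > 0) sequentially"
      by (rule order_tendstoD) simp
    then have "eventually (\<lambda>k. (1 - real \<kappa> * (exp (s / real k) - 1)) ^ k * Gfun m b (t - s)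
        \<le> Gfun m b t) sequentially"
      using eventually_gt_at_top[of 0]
    proof eventually_elim
      case (elim k)
      define q where "q = 1 - real \<kappa> * (exp (s / real k) - 1)"
      have "q ^ i * Gfun m b (t - real i * (s / real k)) \<le> Gfun m b t" for i
      proof (induction i)
        case (Suc i)
        have "q * Gfun m b (t - real (Suc i) * (s / real k)) \<le> Gfun m b (t - real i * (s / real k))"
        proof -
          have "real i * (s / real k) \<ge> 0" using s by simp
          then have "t - real i * (s / real k) \<le> T" using t by linarith
          moreover have "t - real (Suc i) * (s / real k) = t - real i * (s / real k) - s / real k"
            by (simp add: algebra_simps add_divide_distrib)
          ultimately show ?thesis
            using step[of "s / real k" "t - real i * (s / real k)"] s
            by (simp only: q_def mult.commute) simp
        qed
        then have "q ^ i * (q * Gfun m b (t - real (Suc i) * (s / real k)))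
            \<le> q ^ i * Gfun m b (t - real i * (s / real k))"
          using elim by (intro mult_left_mono) (auto simp: q_def)
        then show ?case using Suc by (simp add: mult_ac)
      qed simp
      from this[of k] show ?case using elim by (simp add: q_def)
    qed
    then have "exp (- (real \<kappa> * s)) * Gfun m b (t - s) \<le> Gfun m b t"
      by (intro tendsto_upperbound[OF tendsto_mult_right[OF lim]]) auto
    then show ?thesis by (simp add: exp_minus field_simps)
  qed
  then show ?thesis using that by blast
qed

section \<open>The gamma mixture and the comparison\<close>

text \<open>One factor of the weight at \<open>exp t = L * r\<^sup>2\<close>, with \<open>L\<close>
  in the role of \<open>N\<close>.\<close>

definition wker :: "real \<Rightarrow> real \<Rightarrow> real \<Rightarrow> real \<Rightarrow> ennreal" where
  "wker b q L t = ennreal (exp (b * t) * (1 + exp t / L) powr (- q))"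

text \<open>\<open>mker\<close> is the density of \<open>ln (L / \<tau>)\<close> for a gamma variable \<open>\<tau>\<close> of shape \<open>q\<close>, weighted by \<open>exp (b * s)\<close>.\<close>

definition mker :: "real \<Rightarrow> real \<Rightarrow> real \<Rightarrow> real \<Rightarrow> ennreal" where
  "mker b q L s = ennreal (L powr q / Gamma q * exp ((b - q) * s - L * exp (- s)))"

lemma measurable_wker [measurable]: "wker b q L \<in> borel_measurable borel"
  unfolding wker_def [abs_def] by measurable

lemma measurable_mker [measurable]: "mker b q L \<in> borel_measurable borel"
  unfolding mker_def [abs_def] by measurable

text \<open>Euler's integral writes \<open>(1 + y) powr (- q)\<close> as the mean of
  \<open>exp (- \<tau> * y)\<close> over a gamma variable \<tau> of shape \<open>q\<close>. With
  \<open>y = exp t / L\<close> and \<open>\<tau> = L * exp (- s)\<close> the product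
  \<open>\<tau> * y\<close> is \<open>exp (t - s)\<close>, so the mean is a convolution with
  \<open>gker\<close>.\<close>

lemma conv_mker_gker:
  assumes "q > 0" "L > 0"
  shows "conv (mker b q L) (gker b) = wker b q L"
proof
  fix t
  have pos: "L + exp t > 0" using assms(2) by (simp add: add_pos_pos)
  have G: "Gamma q > 0" using assms by (rule_tac Gamma_real_pos)
  have "conv (mker b q L) (gker b) t
      = (\<integral>\<^sup>+ s. ennreal (L powr q / Gamma q * exp (b * t))
          * ennreal (exp (- q * s - (L + exp t) * exp (- s))) \<partial>lborel)"
    unfolding conv_def mker_def gker_def
  proof (intro nn_integral_cong)
    fix s
    have "exp ((b - q) * s - L * exp (- s)) * exp (b * (t - s) - exp (t - s))
        = exp (b * t) * exp (- q * s - (L + exp t) * exp (- s))"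
      by (simp add: algebra_simps exp_diff exp_minus flip: exp_add) (simp add: field_simps flip: exp_add)
    then show "ennreal (L powr q / Gamma q * exp ((b - q) * s - L * exp (- s)))
          * ennreal (exp (b * (t - s) - exp (t - s)))
        = ennreal (L powr q / Gamma q * exp (b * t))
          * ennreal (exp (- q * s - (L + exp t) * exp (- s)))"
      using G by (simp add: ennreal_mult[symmetric] mult.assoc)
  qed
  also have "\<dots> = ennreal (L powr q / Gamma q * exp (b * t) * ((L + exp t) powr (- q) * Gamma q))"
    using G by (subst nn_integral_cmult) (simp_all only: scaled_gker_mass[OF assms(1) pos], 
      auto simp: ennreal_mult[symmetric])
  also have "L powr q / Gamma q * exp (b * t) * ((L + exp t) powr (- q) * Gamma q)
      = exp (b * t) * (1 + exp t / L) powr (- q)"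
  proof -
    have "1 + exp t / L = (L + exp t) / L" using assms by (simp add: field_simps)
    moreover have "Gamma q \<noteq> 0" using G by linarith
    ultimately show ?thesis using assms pos by (simp add: powr_divide powr_minus field_simps)
  qed
  finally show "conv (mker b q L) (gker b) t = wker b q L t" by (simp add: wker_def)
qed

text \<open>In terms of the gamma variable \<tau> of shape \<open>q\<close> this is the mean of
  \<open>(L / \<tau>) powr (b + k)\<close>, a negative moment when \<open>b + k > 0\<close>; the
  first hypothesis makes it finite.\<close>

lemma mker_mass:
  assumes "q - b - k > 0" "L > 0" "q > 0"
  shows "(\<integral>\<^sup>+ s. mker b q L s * ennreal (exp (k * s)) \<partial>lborel)
    = ennreal (L powr (b + k) * Gamma (q - b - k) / Gamma q)"
proof -
  have G: "Gamma q > 0" "Gamma (q - b - k) > 0" using assms by (auto intro: Gamma_real_pos)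
  have "(\<integral>\<^sup>+ s. mker b q L s * ennreal (exp (k * s)) \<partial>lborel)
     = (\<integral>\<^sup>+ s. ennreal (L powr q / Gamma q) * ennreal (exp (- (q - b - k) * s - L * exp (- s))) \<partial>lborel)"
    unfolding mker_def using G
    by (intro nn_integral_cong) (simp add: ennreal_mult[symmetric] algebra_simps flip: exp_add)
  also have "\<dots> = ennreal (L powr q / Gamma q * (L powr (- (q - b - k)) * Gamma (q - b - k)))"
    using G by (subst nn_integral_cmult) (simp_all only: scaled_gker_mass[OF assms(1,2)], 
      auto simp: ennreal_mult[symmetric])
  also have "L powr q / Gamma q * (L powr (- (q - b - k)) * Gamma (q - b - k))
      = L powr (q + - (q - b - k)) * Gamma (q - b - k) / Gamma q"
    unfolding powr_add by simp
  finally show ?thesis by (simp add: add.commute)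
qed

section \<open>Gamma quotients at integer shifts, and concentration of the mixing kernels\<close>

lemma Gamma_ratio_nat_limit:
  fixes x :: real
  shows "(\<lambda>N. Gamma (real N + x + real k) / (Gamma (real N + x) * real N powr real k)) \<longlonglongrightarrow> 1"
proof (induction k)
  case 0
  have "eventually (\<lambda>N::nat. real N + x > 0) sequentially" by real_asymp
  then have "eventually (\<lambda>N::nat. real N + x > 0 \<and> N > 0) sequentially"
    using eventually_gt_at_top[of 0] by eventually_elim simp
  then have "eventually (\<lambda>N. Gamma (real N + x + real 0) / (Gamma (real N + x) * real N powr real 0) = 1) sequentially"
  proof eventually_elim
    case (elim N)
    then have "Gamma (real N + x) > 0" by (intro Gamma_real_pos) simp
    then have "Gamma (real N + x) \<noteq> 0" by linarith
    then show ?case using elim by simp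
  qed
  then show ?case by (rule tendsto_eventually)
next
  case (Suc k)
  have "(\<lambda>N. (real N + x + real k) / real N) \<longlonglongrightarrow> 1" by real_asymp
  from tendsto_mult[OF Suc this]
  have lim: "(\<lambda>N. Gamma (real N + x + real k) / (Gamma (real N + x) * real N powr real k)
      * ((real N + x + real k) / real N)) \<longlonglongrightarrow> 1" by simp
  have "eventually (\<lambda>N::nat. real N + x > 0) sequentially" by real_asymp
  then have "eventually (\<lambda>N::nat. real N + x > 0 \<and> N > 0) sequentially"
    using eventually_gt_at_top[of 0] by eventually_elim simp
  then have ev: "eventually (\<lambda>N. Gamma (real N + x + real k) / (Gamma (real N + x) * real N powr real k)
      * ((real N + x + real k) / real N)
    = Gamma (real N + x + real (Suc k)) / (Gamma (real N + x) * real N powr real (Suc k))) sequentially"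
  proof eventually_elim
    case (elim N)
    have "real N + x + real k \<noteq> 0" "real N + x + real k \<notin> \<int>\<^sub>\<le>\<^sub>0" using elim by (auto elim!: nonpos_Ints_cases)
    then have "Gamma (real N + x + real (Suc k)) = (real N + x + real k) * Gamma (real N + x + real k)"
      using Gamma_plus1[of "real N + x + real k"] by (simp add: algebra_simps)
    moreover have "real N powr real (Suc k) = real N powr real k * real N"
      using elim by (simp add: powr_realpow del: of_nat_Suc)
    ultimately show ?case by (simp add: field_simps)
  qed
  from Lim_transform_eventually[OF lim ev] show ?case .
qed

text \<open>For \<open>d \<ge> 0\<close> this is the reciprocal of the limit for natural shifts,
  taken at base point \<open>x - d\<close>; for \<open>d < 0\<close> it is that limit
  itself.\<close>

lemma Gamma_ratio_limit:
  fixes x d :: real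
  assumes "d \<in> \<int>"
  shows "(\<lambda>N. real N powr d * Gamma (real N + x - d) / Gamma (real N + x)) \<longlonglongrightarrow> 1"
proof -
  obtain i :: int where i: "d = of_int i" using assms by (auto elim: Ints_cases)
  show ?thesis
  proof (cases "i \<ge> 0")
    case True
    then have d: "d = real (nat i)" using i by simp
    have lim: "(\<lambda>N. inverse (Gamma (real N + (x - d) + real (nat i))
        / (Gamma (real N + (x - d)) * real N powr real (nat i)))) \<longlonglongrightarrow> inverse 1"
      by (intro tendsto_inverse Gamma_ratio_nat_limit) simp
    then show ?thesis by (simp add: d divide_simps mult.commute add_diff_eq)
  next
    case False
    then have d: "d = - real (nat (- i))" using i by simp
    show ?thesis using Gamma_ratio_nat_limit[of x "nat (- i)"]
      by (simp add: d powr_minus field_simps)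
  qed
qed

text \<open>A second-moment argument: the masses against 1, \<open>exp (\<kappa> * s)\<close> and
  its square all tend to 1, so the mass of \<open>(exp (\<kappa> * s) - 1)\<^sup>2\<close> tends to
  0.\<close>

lemma mker_weighted_mass:
  fixes b u \<epsilon> :: real and \<kappa> :: nat
  assumes "b \<in> \<int>" and \<epsilon>: "\<epsilon> > 0"
  shows "eventually (\<lambda>N. (\<integral>\<^sup>+ s. mker b (real N + u) (real N) s
      * ennreal (max 1 (exp (real \<kappa> * s))) \<partial>lborel) \<le> ennreal (1 + \<epsilon>)) sequentially"
proof -
  \<comment> \<open>The quadratic majorant has limiting mass \<open>1 + \<eta>\<close>; halving
    \<epsilon> leaves the strict gap needed to reach \<open>1 + \<epsilon>\<close> for large
    \<open>N\<close>.\<close>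
  define \<eta> where "\<eta> = \<epsilon> / 2"
  have \<eta>: "\<eta> > 0" using \<epsilon> by (simp add: \<eta>_def)
  define a where "a k N = real N powr (b + k) * Gamma (real N + u - (b + k)) / Gamma (real N + u)"
    for k :: real and N :: nat
  have lim: "a k \<longlonglongrightarrow> 1" if "k \<in> \<int>" for k
    unfolding a_def by (rule Gamma_ratio_limit) (use assms that in auto)
  have "(\<lambda>N. (1 + \<eta> + 1 / (4 * \<eta>)) * a 0 N + 1 / (4 * \<eta>) * a (2 * real \<kappa>) N
      - 1 / (2 * \<eta>) * a (real \<kappa>) N) \<longlonglongrightarrow> (1 + \<eta> + 1 / (4 * \<eta>)) * 1 + 1 / (4 * \<eta>) * 1 - 1 / (2 * \<eta>) * 1"
    by (intro tendsto_intros lim) auto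
  also have "(1 + \<eta> + 1 / (4 * \<eta>)) * 1 + 1 / (4 * \<eta>) * 1 - 1 / (2 * \<eta>) * 1 = 1 + \<eta>"
    using \<eta> by (simp add: field_simps)
  finally have "eventually (\<lambda>N. (1 + \<eta> + 1 / (4 * \<eta>)) * a 0 N + 1 / (4 * \<eta>) * a (2 * real \<kappa>) N
      - 1 / (2 * \<eta>) * a (real \<kappa>) N < 1 + \<epsilon>) sequentially"
    by (rule order_tendstoD) (use \<epsilon> in \<open>simp add: \<eta>_def\<close>)
  moreover have "eventually (\<lambda>N::nat. real N + u > 0) sequentially"
    "eventually (\<lambda>N::nat. real N + u - b - 2 * real \<kappa> > 0) sequentially" by real_asymp+
  then have "eventually (\<lambda>N::nat. real N + u > 0 \<and> N > 0 \<and> real N + u - b - 2 * real \<kappa> > 0) sequentially"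
    using eventually_gt_at_top[of 0] by eventually_elim simp
  ultimately show ?thesis
  proof eventually_elim
    case (elim N)
    define q where "q = real N + u"
    define U where "U = (\<integral>\<^sup>+ s. mker b q (real N) s * ennreal (max 1 (exp (real \<kappa> * s))) \<partial>lborel)"
    have pk: "q - b - 0 > 0" "q - b - real \<kappa> > 0" "q - b - 2 * real \<kappa> > 0"
      using elim by (auto simp: q_def)
    have apos: "a k N \<ge> 0" if "q - b - k > 0" for k
      using that elim unfolding a_def q_def
      by (intro divide_nonneg_nonneg mult_nonneg_nonneg) (auto intro!: less_imp_le Gamma_real_pos)
    have mass: "(\<integral>\<^sup>+ s. mker b q (real N) s * ennreal (exp (k * s)) \<partial>lborel) = ennreal (a k N)"
      if "q - b - k > 0" for k
      using that elim by (subst mker_mass) (auto simp: q_def a_def algebra_simps)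
    have mass': "(\<integral>\<^sup>+ s. ennreal c * (mker b q (real N) s * ennreal (exp (k * s))) \<partial>lborel)
        = ennreal (c * a k N)" if "q - b - k > 0" "c \<ge> 0" for k c
      using that by (subst nn_integral_cmult) (auto simp: mass ennreal_mult apos)
    \<comment> \<open>The linear term of the quadratic majorant is negative. It is carried on the
      left, since subtraction in \<open>ennreal\<close> is truncated.\<close>
    have "U + ennreal (1 / (2 * \<eta>) * a (real \<kappa>) N)
      = (\<integral>\<^sup>+ s. mker b q (real N) s * ennreal (max 1 (exp (real \<kappa> * s)))
          + ennreal (1 / (2 * \<eta>)) * (mker b q (real N) s * ennreal (exp (real \<kappa> * s))) \<partial>lborel)"
      using \<eta> elim unfolding U_def
      by (subst nn_integral_add, measurable) (subst mass'[OF pk(2)], auto)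
    also have "\<dots> \<le> (\<integral>\<^sup>+ s. ennreal (1 + \<eta> + 1 / (4 * \<eta>)) * (mker b q (real N) s * ennreal (exp (0 * s)))
          + ennreal (1 / (4 * \<eta>)) * (mker b q (real N) s * ennreal (exp (2 * real \<kappa> * s))) \<partial>lborel)"
    proof (rule nn_integral_mono)
      fix s
      define y where "y = exp (real \<kappa> * s)"
      have y2: "exp (2 * real \<kappa> * s) = y\<^sup>2" by (simp add: y_def power2_eq_square flip: exp_add)
      have y: "y > 0" by (simp add: y_def)
      have "0 \<le> (2 * \<eta> - (y - 1))\<^sup>2" "0 \<le> (y - 1)\<^sup>2" by simp_all
      \<comment> \<open>\<open>max 1 y \<le> 1 + \<bar>y - 1\<bar> \<le> 1 + \<eta> + (y - 1)\<^sup>2 / (4 * \<eta>)\<close>, and the moments of the last term tend to 0\<close>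
      then have "4 * \<eta> * max 1 y + 2 * y \<le> 4 * \<eta> + 4 * \<eta>\<^sup>2 + 1 + y\<^sup>2"
      proof (cases "1 \<le> y")
        case False
        have "2 * y \<le> 1 + y\<^sup>2"
          using \<open>0 \<le> (y - 1)\<^sup>2\<close> by (simp add: power2_eq_square algebra_simps)
        moreover have "0 \<le> 4 * \<eta>\<^sup>2" by simp
        moreover have m: "max 1 y = 1" using False by simp
        ultimately show ?thesis unfolding m by linarith
      qed (simp add: power2_eq_square algebra_simps)
      moreover have "4 * \<eta> * (max 1 y + 1 / (2 * \<eta>) * y) = 4 * \<eta> * max 1 y + 2 * y"
        "4 * \<eta> * ((1 + \<eta> + 1 / (4 * \<eta>)) * 1 + 1 / (4 * \<eta>) * y\<^sup>2) = 4 * \<eta> + 4 * \<eta>\<^sup>2 + 1 + y\<^sup>2"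
        using \<eta> by (simp_all add: distrib_left power2_eq_square)
      ultimately have "4 * \<eta> * (max 1 y + 1 / (2 * \<eta>) * y)
          \<le> 4 * \<eta> * ((1 + \<eta> + 1 / (4 * \<eta>)) * 1 + 1 / (4 * \<eta>) * y\<^sup>2)" by simp
      then have "max 1 y + 1 / (2 * \<eta>) * y \<le> (1 + \<eta> + 1 / (4 * \<eta>)) * 1 + 1 / (4 * \<eta>) * y\<^sup>2"
        using \<eta> by (subst (asm) mult_le_cancel_left_pos) auto
      then have "ennreal (1 * max 1 y + 1 / (2 * \<eta>) * y)
          \<le> ennreal ((1 + \<eta> + 1 / (4 * \<eta>)) * 1 + 1 / (4 * \<eta>) * y\<^sup>2)"
        by (intro ennreal_leI) simp
      moreover have "ennreal 1 * ennreal (max 1 y) + ennreal (1 / (2 * \<eta>)) * ennreal y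
          = ennreal (1 * max 1 y + 1 / (2 * \<eta>) * y)"
        using \<eta> y by (intro ennreal_linear) auto
      moreover have "ennreal (1 + \<eta> + 1 / (4 * \<eta>)) * ennreal 1 + ennreal (1 / (4 * \<eta>)) * ennreal (y\<^sup>2)
          = ennreal ((1 + \<eta> + 1 / (4 * \<eta>)) * 1 + 1 / (4 * \<eta>) * y\<^sup>2)"
        using \<eta> y by (intro ennreal_linear) auto
      ultimately have "ennreal 1 * ennreal (max 1 y) + ennreal (1 / (2 * \<eta>)) * ennreal y
          \<le> ennreal (1 + \<eta> + 1 / (4 * \<eta>)) * ennreal 1 + ennreal (1 / (4 * \<eta>)) * ennreal (y\<^sup>2)"
        by (simp only:)
      then have "mker b q (real N) s * (ennreal 1 * ennreal (max 1 y) + ennreal (1 / (2 * \<eta>)) * ennreal y)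
          \<le> mker b q (real N) s * (ennreal (1 + \<eta> + 1 / (4 * \<eta>)) * ennreal 1 + ennreal (1 / (4 * \<eta>)) * ennreal (y\<^sup>2))"
        by (rule mult_left_mono) simp
      then show "mker b q (real N) s * ennreal (max 1 (exp (real \<kappa> * s)))
          + ennreal (1 / (2 * \<eta>)) * (mker b q (real N) s * ennreal (exp (real \<kappa> * s)))
        \<le> ennreal (1 + \<eta> + 1 / (4 * \<eta>)) * (mker b q (real N) s * ennreal (exp (0 * s)))
          + ennreal (1 / (4 * \<eta>)) * (mker b q (real N) s * ennreal (exp (2 * real \<kappa> * s)))"
        unfolding y2 by (fold y_def) (simp add: distrib_left mult_ac)
    qed
    also have "\<dots> = ennreal ((1 + \<eta> + 1 / (4 * \<eta>)) * a 0 N) + ennreal (1 / (4 * \<eta>) * a (2 * real \<kappa>) N)"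
      using \<eta> by (subst nn_integral_add, measurable)
        (subst mass'[OF pk(1)] mass'[OF pk(3)]; (subst mass'[OF pk(3)])?; auto)
    also have "\<dots> = ennreal ((1 + \<eta> + 1 / (4 * \<eta>)) * a 0 N + 1 / (4 * \<eta>) * a (2 * real \<kappa>) N)"
      using \<eta> pk by (intro ennreal_plus[symmetric] mult_nonneg_nonneg apos) auto
    finally have le: "U + ennreal (1 / (2 * \<eta>) * a (real \<kappa>) N)
      \<le> ennreal ((1 + \<eta> + 1 / (4 * \<eta>)) * a 0 N + 1 / (4 * \<eta>) * a (2 * real \<kappa>) N)" .
    have a1: "1 / (2 * \<eta>) * a (real \<kappa>) N \<ge> 0"
      using \<eta> pk by (intro mult_nonneg_nonneg apos) auto
    obtain r where r: "U = ennreal r" "r \<ge> 0"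
      using le by (cases U) (auto simp: top_unique)
    have "ennreal (r + 1 / (2 * \<eta>) * a (real \<kappa>) N)
      \<le> ennreal ((1 + \<eta> + 1 / (4 * \<eta>)) * a 0 N + 1 / (4 * \<eta>) * a (2 * real \<kappa>) N)"
      using le r a1 by simp
    then have "r + 1 / (2 * \<eta>) * a (real \<kappa>) N
        \<le> (1 + \<eta> + 1 / (4 * \<eta>)) * a 0 N + 1 / (4 * \<eta>) * a (2 * real \<kappa>) N"
      using \<eta> pk
      by (subst (asm) ennreal_le_iff) (auto intro!: add_nonneg_nonneg mult_nonneg_nonneg divide_nonneg_nonneg apos)
    then have "r \<le> 1 + \<epsilon>" using elim by linarith
    then show ?case using r by (auto simp: U_def q_def intro!: ennreal_leI)
  qed
qed

text \<open>The inequality \<open>ln (1 + y) \<le> y\<close> replaces the power by an exponential of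
  rate \<open>q / L \<le> p / L\<close>, and the rate becomes a translation. Since
  \<open>b \<le> 0\<close> and \<open>p \<ge> L\<close>, translating only lowers
  \<open>exp (b * t)\<close>. A common \<open>p\<close> gives all factors the same translation
  although their exponents differ.\<close>

lemma wker_ge_gker:
  assumes "b \<le> 0" "0 \<le> q" "q \<le> p" "L \<le> p" "L > 0"
  shows "gker b (t + ln (p / L)) \<le> wker b q L t"
proof -
  have "exp (b * (t + ln (p / L))) \<le> exp (b * t)"
    using assms by (auto simp: algebra_simps intro!: mult_nonpos_nonneg)
  moreover have "exp (- exp (t + ln (p / L))) \<le> (1 + exp t / L) powr (- q)"
  proof -
    have pos: "1 + exp t / L > 0" using assms by (simp add: add_pos_pos)
    have "q * ln (1 + exp t / L) \<le> q * (exp t / L)"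
      using assms by (intro mult_left_mono ln_add_one_self_le_self) auto
    also have "\<dots> \<le> p * (exp t / L)" using assms by (intro mult_right_mono) auto
    also have "\<dots> = exp (t + ln (p / L))" using assms by (simp add: exp_add)
    finally show ?thesis using pos by (simp add: powr_def)
  qed
  ultimately have "exp (b * (t + ln (p / L))) * exp (- exp (t + ln (p / L)))
      \<le> exp (b * t) * (1 + exp t / L) powr (- q)"
    by (intro mult_mono) auto
  then show ?thesis
    unfolding gker_def wker_def by (intro ennreal_leI) (simp flip: exp_add)
qed

text \<open>With \<open>b j = \<nu> j - \<nu> n\<close> and \<open>d = \<nu> n\<close> the exponents
  are \<open>\<nu> j + N + 1\<close>; the seed is the factor \<open>j = n\<close>.\<close>

definition Wfun :: "nat \<Rightarrow> (nat \<Rightarrow> real) \<Rightarrow> real \<Rightarrow> nat \<Rightarrow> real \<Rightarrow> ennreal" where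
  "Wfun m b d N = mconv (\<lambda>j. wker (b j) (real N + (b j + d + 1)) (real N)) m
     (wker 0 (real N + (d + 1)) (real N))"

text \<open>Every weight kernel splits into a mixing kernel and a limit kernel. By commutativity the
  mixing kernels gather into one and the limit kernels into \<open>Gfun\<close>.\<close>

lemma Wfun_eq_conv:
  assumes "\<And>j. j \<in> {1..m} \<Longrightarrow> b j + d \<ge> 0" "d \<ge> 0" "N > 0"
  shows "Wfun m b d N = conv (mconv (\<lambda>j. mker (b j) (real N + (b j + d + 1)) (real N)) m
      (mker 0 (real N + (d + 1)) (real N))) (\<lambda>t. ennreal (Gfun m b t))"
proof -
  define M where "M = (\<lambda>j. mker (b j) (real N + (b j + d + 1)) (real N))"
  define M0 where "M0 = mker 0 (real N + (d + 1)) (real N)"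
  define G where "G = mconv (\<lambda>j. gker (b j)) m (gker 0)"
  have [measurable]: "M j \<in> borel_measurable borel" "M0 \<in> borel_measurable borel"
    "G \<in> borel_measurable borel" for j
    by (auto simp: M_def M0_def G_def)
  have w0: "wker 0 (real N + (d + 1)) (real N) = conv M0 (gker 0)"
    unfolding M0_def by (rule conv_mker_gker[symmetric]) (use assms in auto)
  have "real N + (b j + d + 1) > 0" if "j \<in> {1..m}" for j
    using assms(1)[OF that] by linarith
  then have "Wfun m b d N = mconv (\<lambda>j. conv (M j) (gker (b j))) m (conv M0 (gker 0))"
    unfolding Wfun_def w0 M_def using assms(3)
    by (intro mconv_cong conv_mker_gker[symmetric]) auto
  also have "\<dots> = mconv M m (conv M0 G)"
    unfolding G_def by (simp add: mconv_conv_kernels mconv_conv)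
  also have "conv M0 G = conv G M0" by (rule conv_commute) auto
  also have "mconv M m (conv G M0) = conv G (mconv M m M0)" by (rule mconv_conv) auto
  also have "\<dots> = conv (mconv M m M0) G" by (rule conv_commute) auto
  finally show ?thesis by (simp add: M_def M0_def G_def ennreal_Gfun)
qed

lemma Wfun_upper:
  assumes b: "\<And>j. j \<in> {1..m} \<Longrightarrow> b j \<le> 0 \<and> b j + d \<ge> 0 \<and> b j \<in> \<int>" and d: "d \<ge> 0"
    and \<epsilon>: "\<epsilon> > 0"
  shows "eventually (\<lambda>N. \<forall>t\<le>T. Wfun m b d N t \<le> ennreal ((1 + \<epsilon>) * Gfun m b t)) sequentially"
proof -
  obtain \<kappa> :: nat where \<kappa>: "\<And>s t. 0 \<le> s \<Longrightarrow> t \<le> T \<Longrightarrow> Gfun m b (t - s) \<le> exp (real \<kappa> * s) * Gfun m b t"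
    using Gfun_doubling[of m b T] b by blast
  \<comment> \<open>There are \<open>Suc m\<close> mixing kernels, one of them from the seed. A mass
    of at most \<open>1 + \<eta>\<close> for each has to multiply to less than
    \<open>1 + \<epsilon>\<close>.\<close>
  have "((\<lambda>\<eta>. (1 + \<eta>) ^ Suc m) \<longlongrightarrow> (1 + 0) ^ Suc m) (at_right (0::real))"
    by (intro tendsto_intros)
  then have "eventually (\<lambda>\<eta>. (1 + \<eta>) ^ Suc m < 1 + \<epsilon>) (at_right (0::real))"
    by (rule order_tendstoD) (use \<epsilon> in simp)
  moreover have "eventually (\<lambda>\<eta>. \<eta> > 0) (at_right (0::real))"
    by (rule eventually_at_right_less)
  ultimately have "eventually (\<lambda>\<eta>. (1 + \<eta>) ^ Suc m < 1 + \<epsilon> \<and> \<eta> > 0) (at_right (0::real))"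
    by eventually_elim auto
  then obtain \<eta> :: real where \<eta>: "(1 + \<eta>) ^ Suc m < 1 + \<epsilon>" "\<eta> > 0"
    using eventually_happens[of _ "at_right (0::real)"] by (auto simp: trivial_limit_at_right_real)
  \<comment> \<open>For \<open>s \<ge> 0\<close> the quotient of \<open>Gfun\<close> at
    \<open>t - s\<close> and \<open>t\<close> is at most \<open>exp (\<kappa> * s)\<close>, for
    \<open>s < 0\<close> at most 1 by monotonicity. The maximum covers both and is
    submultiplicative.\<close>
  define w where "w s = ennreal (max 1 (exp (real \<kappa> * s)))" for s
  have [measurable]: "w \<in> borel_measurable borel" unfolding w_def [abs_def] by measurable
  have sub: "w (s + r) \<le> w s * w r" for s r
  proof -
    have "max 1 (exp (real \<kappa> * s)) * max 1 (exp (real \<kappa> * r)) \<ge> 1 * 1"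
      "max 1 (exp (real \<kappa> * s)) * max 1 (exp (real \<kappa> * r)) \<ge> exp (real \<kappa> * s) * exp (real \<kappa> * r)"
      by (intro mult_mono; simp)+
    then have "max 1 (exp (real \<kappa> * (s + r))) \<le> max 1 (exp (real \<kappa> * s)) * max 1 (exp (real \<kappa> * r))"
      by (simp add: exp_add algebra_simps)
    then show ?thesis unfolding w_def by (subst ennreal_mult[symmetric]) (auto intro!: ennreal_leI)
  qed
  have ev: "eventually (\<lambda>N. (\<integral>\<^sup>+ s. mker c (real N + u) (real N) s * w s \<partial>lborel) \<le> ennreal (1 + \<eta>)) sequentially"
    if "c \<in> \<int>" for c u
    unfolding w_def by (rule mker_weighted_mass[OF that \<eta>(2)])
  have "eventually (\<lambda>N. \<forall>j\<in>{1..m}. (\<integral>\<^sup>+ s. mker (b j) (real N + (b j + d + 1)) (real N) s * w s \<partial>lborel)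
      \<le> ennreal (1 + \<eta>)) sequentially"
    using b by (intro eventually_ball_finite ballI ev) auto
  moreover have "eventually (\<lambda>N. (\<integral>\<^sup>+ s. mker 0 (real N + (d + 1)) (real N) s * w s \<partial>lborel)
      \<le> ennreal (1 + \<eta>)) sequentially"
    by (rule ev) auto
  moreover have "eventually (\<lambda>N::nat. N > 0) sequentially" by (rule eventually_gt_at_top)
  ultimately show ?thesis
  proof eventually_elim
    case (elim N)
    define M where "M = (\<lambda>j. mker (b j) (real N + (b j + d + 1)) (real N))"
    define M0 where "M0 = mker 0 (real N + (d + 1)) (real N)"
    define MM where "MM = mconv M m M0"
    have [measurable]: "M j \<in> borel_measurable borel" "M0 \<in> borel_measurable borel" for j
      by (auto simp: M_def M0_def)
    have [measurable]: "MM \<in> borel_measurable borel" unfolding MM_def by measurable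
    have "(\<integral>\<^sup>+ s. MM s * w s \<partial>lborel)
      \<le> (\<Prod>j\<in>{1..m}. \<integral>\<^sup>+ t. M j t * w t \<partial>lborel) * (\<integral>\<^sup>+ t. M0 t * w t \<partial>lborel)"
      unfolding MM_def by (rule mconv_weighted_mass[OF _ _ _ sub]) auto
    also have "\<dots> \<le> (\<Prod>j\<in>{1..m}. ennreal (1 + \<eta>)) * ennreal (1 + \<eta>)"
      using elim by (intro mult_mono prod_mono_ennreal) (auto simp: M_def M0_def)
    also have "\<dots> = ennreal ((1 + \<eta>) ^ Suc m)"
      using \<eta> by (simp add: ennreal_power[symmetric] ennreal_mult mult.commute)
    also have "\<dots> \<le> ennreal (1 + \<epsilon>)" using \<eta> by (intro ennreal_leI) auto
    finally have mass: "(\<integral>\<^sup>+ s. MM s * w s \<partial>lborel) \<le> ennreal (1 + \<epsilon>)" .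
    show ?case
    proof (intro allI impI)
      fix t assume t: "t \<le> T"
      have "Wfun m b d N t = (\<integral>\<^sup>+ s. MM s * ennreal (Gfun m b (t - s)) \<partial>lborel)"
        using b d elim by (subst Wfun_eq_conv) (auto simp: MM_def M_def M0_def conv_def)
      also have "\<dots> \<le> (\<integral>\<^sup>+ s. MM s * w s * ennreal (Gfun m b t) \<partial>lborel)"
      proof (rule nn_integral_mono)
        fix s
        have "Gfun m b (t - s) \<le> max 1 (exp (real \<kappa> * s)) * Gfun m b t"
        proof (cases "s \<ge> 0")
          case True
          then have "Gfun m b (t - s) \<le> exp (real \<kappa> * s) * Gfun m b t" using \<kappa> t by auto
          also have "\<dots> \<le> max 1 (exp (real \<kappa> * s)) * Gfun m b t"
            using Gfun_pos[of m b t] by (intro mult_right_mono) auto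
          finally show ?thesis .
        next
          case False
          then have "Gfun m b (t - s) \<le> 1 * Gfun m b t" by (simp add: Gfun_antimono)
          also have "\<dots> \<le> max 1 (exp (real \<kappa> * s)) * Gfun m b t"
            using Gfun_pos[of m b t] by (intro mult_right_mono) auto
          finally show ?thesis .
        qed
        then have "ennreal (Gfun m b (t - s)) \<le> w s * ennreal (Gfun m b t)"
          unfolding w_def using Gfun_pos[of m b t]
          by (subst ennreal_mult[symmetric]) (auto intro!: ennreal_leI)
        then show "MM s * ennreal (Gfun m b (t - s)) \<le> MM s * w s * ennreal (Gfun m b t)"
          by (simp add: mult.assoc mult_left_mono)
      qed
      also have "\<dots> = (\<integral>\<^sup>+ s. MM s * w s \<partial>lborel) * ennreal (Gfun m b t)"
        by (rule nn_integral_multc) auto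
      also have "\<dots> \<le> ennreal (1 + \<epsilon>) * ennreal (Gfun m b t)"
        by (intro mult_right_mono mass) auto
      also have "\<dots> = ennreal ((1 + \<epsilon>) * Gfun m b t)"
        using \<epsilon> Gfun_pos[of m b t] by (intro ennreal_mult[symmetric]) auto
      finally show "Wfun m b d N t \<le> ennreal ((1 + \<epsilon>) * Gfun m b t)" .
    qed
  qed
qed

lemma Wfun_lower:
  assumes b: "\<And>j. j \<in> {1..m} \<Longrightarrow> b j \<le> 0 \<and> b j + d \<ge> 0" and d: "d \<ge> 0"
    and \<epsilon>: "\<epsilon> > 0"
  shows "eventually (\<lambda>N. \<forall>t\<le>T. ennreal ((1 - \<epsilon>) * Gfun m b t) \<le> Wfun m b d N t) sequentially"
proof -
  \<comment> \<open>The growth bound is applied at \<open>t + \<delta> N\<close>, and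
    \<open>\<delta> N < 1\<close> eventually; hence \<open>T + 1\<close>.\<close>
  obtain \<kappa> :: nat where \<kappa>: "\<And>s t. 0 \<le> s \<Longrightarrow> t \<le> T + 1 \<Longrightarrow> Gfun m b (t - s) \<le> exp (real \<kappa> * s) * Gfun m b t"
    using Gfun_doubling[of m b "T + 1"] b by blast
  \<comment> \<open>\<open>real N + (d + 1)\<close> is the largest of the exponents, since
    \<open>b j \<le> 0\<close>; it serves as the common \<open>p\<close> of
    \<open>wker_ge_gker\<close>. The total translation is \<open>Suc m\<close> times the single
    one.\<close>
  define \<delta> where "\<delta> N = real (Suc m) * ln ((real N + (d + 1)) / real N)" for N :: nat
  have lim: "\<delta> \<longlonglongrightarrow> 0" unfolding \<delta>_def by real_asymp
  have "eventually (\<lambda>N. \<delta> N < 1) sequentially" using lim by (rule order_tendstoD) simp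
  moreover have "(\<lambda>N. exp (- (real \<kappa> * \<delta> N))) \<longlonglongrightarrow> exp (- (real \<kappa> * 0))"
    by (intro tendsto_intros lim)
  then have "eventually (\<lambda>N. exp (- (real \<kappa> * \<delta> N)) > 1 - \<epsilon>) sequentially"
    by (rule order_tendstoD) (use \<epsilon> in simp)
  ultimately show ?thesis using eventually_gt_at_top[of 0]
  proof eventually_elim
    case (elim N)
    show ?case
    proof (intro allI impI)
      fix t assume t: "t \<le> T"
      have \<delta>0: "\<delta> N \<ge> 0" using elim d by (auto simp: \<delta>_def intro!: mult_nonneg_nonneg)
      have "Gfun m b (t + \<delta> N - \<delta> N) \<le> exp (real \<kappa> * \<delta> N) * Gfun m b (t + \<delta> N)"
        using \<delta>0 elim t by (intro \<kappa>) auto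
      then have "exp (- (real \<kappa> * \<delta> N)) * Gfun m b t \<le> Gfun m b (t + \<delta> N)"
        by (simp add: exp_minus field_simps)
      moreover have "(1 - \<epsilon>) * Gfun m b t \<le> exp (- (real \<kappa> * \<delta> N)) * Gfun m b t"
        using elim Gfun_pos[of m b t] by (intro mult_right_mono) auto
      ultimately have "ennreal ((1 - \<epsilon>) * Gfun m b t) \<le> ennreal (Gfun m b (t + \<delta> N))"
        by (intro ennreal_leI) linarith
      also have "\<dots> = mconv (\<lambda>j s. gker (b j) (s + ln ((real N + (d + 1)) / real N))) m
          (\<lambda>s. gker 0 (s + ln ((real N + (d + 1)) / real N))) t"
        unfolding ennreal_Gfun \<delta>_def by (rule mconv_shift[symmetric]) auto
      also have "\<dots> \<le> Wfun m b d N t"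
        unfolding Wfun_def
      proof (rule mconv_mono)
        fix j s assume j: "j \<in> {1..m}"
        show "gker (b j) (s + ln ((real N + (d + 1)) / real N))
            \<le> wker (b j) (real N + (b j + d + 1)) (real N) s"
          using b[OF j] d elim by (intro wker_ge_gker) auto
      next
        fix s show "gker 0 (s + ln ((real N + (d + 1)) / real N))
            \<le> wker 0 (real N + (d + 1)) (real N) s"
          using d elim by (intro wker_ge_gker) auto
      qed
      finally show "ennreal ((1 - \<epsilon>) * Gfun m b t) \<le> Wfun m b d N t" .
    qed
  qed
qed

section \<open>Fourier inversion and the Mellin-Barnes integral\<close>

text \<open>The transform is damped by a Gaussian, whose own transform is the normal density.\<close>

lemma fourier_inversion:
  fixes f :: "real \<Rightarrow> complex"
  assumes f: "integrable lborel f" and B: "\<And>x. norm (f x) \<le> B" and cont: "isCont f t"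
  defines "F \<equiv> \<lambda>\<tau>. LINT s|lborel. f s * iexp (\<tau> * s)"
  assumes F: "integrable lborel F"
  shows "(LINT \<tau>|lborel. F \<tau> * iexp (- (\<tau> * t))) = 2 * pi * f t"
proof -
  have [measurable]: "f \<in> borel_measurable borel" "F \<in> borel_measurable borel"
    using f F by auto
  define \<delta> where "\<delta> k = inverse (real (Suc k))" for k
  have \<delta>: "\<delta> k > 0" for k by (simp add: \<delta>_def)
  have \<delta>0: "\<delta> \<longlonglongrightarrow> 0" unfolding \<delta>_def by (rule LIMSEQ_inverse_real_of_nat)
  define g where "g k \<tau> = complex_of_real (exp (- (\<delta> k * \<tau>)\<^sup>2 / 2))" for k \<tau>
  have [measurable]: "g k \<in> borel_measurable borel" for k unfolding g_def by measurable
  have dens: "std_normal_density x = exp (- x\<^sup>2 / 2) / sqrt (2 * pi)" for x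
    by (simp add: std_normal_density_def)
  have char: "(LINT x|lborel. complex_of_real (exp (- x\<^sup>2 / 2)) * iexp (u * x))
      = sqrt (2 * pi) * exp (- u\<^sup>2 / 2)" for u
  proof -
    have "complex_of_real (exp (- u\<^sup>2 / 2)) = char std_normal_distribution u"
      by (simp add: char_std_normal_distribution)
    also have "\<dots> = (LINT x|lborel. std_normal_density x *\<^sub>R iexp (u * x))"
      unfolding char_def by (subst integral_density) (auto simp: less_imp_le)
    also have "\<dots> = (LINT x|lborel. (complex_of_real (exp (- x\<^sup>2 / 2)) * iexp (u * x)) / sqrt (2 * pi))"
      by (intro Bochner_Integration.integral_cong) (auto simp: dens scaleR_conv_of_real)
    also have "\<dots> = (LINT x|lborel. complex_of_real (exp (- x\<^sup>2 / 2)) * iexp (u * x)) / sqrt (2 * pi)"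
      by simp
    finally show ?thesis by (simp add: field_simps)
  qed
  have gauss: "(LINT \<tau>|lborel. g k \<tau> * iexp (\<tau> * v)) = sqrt (2 * pi) / \<delta> k * exp (- (v / \<delta> k)\<^sup>2 / 2)" for k v
  proof -
    have "(LINT \<tau>|lborel. g k \<tau> * iexp (\<tau> * v))
       = \<bar>1 / \<delta> k\<bar> *\<^sub>R (LINT x|lborel. g k (0 + 1 / \<delta> k * x) * iexp ((0 + 1 / \<delta> k * x) * v))"
      by (rule lborel_integral_real_affine) (use \<delta>[of k] in auto)
    also have "(\<lambda>x. g k (0 + 1 / \<delta> k * x) * iexp ((0 + 1 / \<delta> k * x) * v))
       = (\<lambda>x. complex_of_real (exp (- x\<^sup>2 / 2)) * iexp ((v / \<delta> k) * x))"
      using \<delta>[of k] by (auto simp: g_def fun_eq_iff field_simps)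
    finally show ?thesis using \<delta>[of k] unfolding char by (simp add: scaleR_conv_of_real field_simps)
  qed
  have int_gauss: "integrable lborel (\<lambda>x. exp (- x\<^sup>2 / 2) :: real)"
    using integrable_mult_right[of "sqrt (2 * pi)" lborel std_normal_density] integrable_std_normal_moment[of 0]
    by (simp add: dens)
  have int_g: "integrable lborel (\<lambda>\<tau>. norm (g k \<tau>))" for k
    using lborel_integrable_real_affine[OF int_gauss, of "\<delta> k" 0] \<delta>[of k] by (simp add: g_def)
  \<comment> \<open>Fubini moves the Gaussian damping over to \<open>f\<close>: the damped inverse
    transform is an average of \<open>f\<close> around \<open>t\<close> on the scale
    \<open>\<delta> k\<close>.\<close>
  have eq: "(LINT \<tau>|lborel. F \<tau> * iexp (- (\<tau> * t)) * g k \<tau>)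
      = 2 * pi * (LINT x|lborel. f (t + \<delta> k * x) * std_normal_density x)" for k
  proof -
    have "(LINT \<tau>|lborel. F \<tau> * iexp (- (\<tau> * t)) * g k \<tau>)
      = (LINT \<tau>|lborel. LINT s|lborel. f s * (g k \<tau> * iexp (\<tau> * (s - t))))"
    proof (intro Bochner_Integration.integral_cong refl)
      fix \<tau>
      have "F \<tau> * iexp (- (\<tau> * t)) * g k \<tau> = (LINT s|lborel. f s * iexp (\<tau> * s) * (iexp (- (\<tau> * t)) * g k \<tau>))"
        by (simp only: integral_mult_left_zero F_def) (simp only: mult.assoc)
      also have "\<dots> = (LINT s|lborel. f s * (g k \<tau> * iexp (\<tau> * (s - t))))"
        by (intro Bochner_Integration.integral_cong refl) (simp add: algebra_simps flip: exp_add)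
      finally show "F \<tau> * iexp (- (\<tau> * t)) * g k \<tau> = (LINT s|lborel. f s * (g k \<tau> * iexp (\<tau> * (s - t))))" .
    qed
    also have "\<dots> = (LINT s|lborel. LINT \<tau>|lborel. f s * (g k \<tau> * iexp (\<tau> * (s - t))))"
    proof (rule lborel_pair.Fubini_integral, rule lborel_pair.Fubini_integrable)
      have "(\<lambda>s. LINT \<tau>|lborel. norm (f s * (g k \<tau> * iexp (\<tau> * (s - t)))))
          = (\<lambda>s. norm (f s) * (LINT \<tau>|lborel. norm (g k \<tau>)))"
        by (simp add: norm_mult)
      then show "integrable lborel (\<lambda>s. LINT \<tau>|lborel. norm (case (s, \<tau>) of (s, \<tau>) \<Rightarrow> f s * (g k \<tau> * iexp (\<tau> * (s - t)))))"
        using f by simp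
      show "AE s in lborel. integrable lborel (\<lambda>\<tau>. case (s, \<tau>) of (s, \<tau>) \<Rightarrow> f s * (g k \<tau> * iexp (\<tau> * (s - t))))"
      proof (rule AE_I2)
        fix s
        show "integrable lborel (\<lambda>\<tau>. case (s, \<tau>) of (s, \<tau>) \<Rightarrow> f s * (g k \<tau> * iexp (\<tau> * (s - t))))"
          by (rule Bochner_Integration.integrable_bound[OF integrable_mult_right[OF int_g, of "norm (f s)" k]])
             (auto simp: norm_mult)
      qed
    qed measurable
    also have "\<dots> = (LINT s|lborel. f s * (sqrt (2 * pi) / \<delta> k * exp (- ((s - t) / \<delta> k)\<^sup>2 / 2)))"
      by (simp only: integral_mult_right_zero gauss)
    also have "\<dots> = \<bar>\<delta> k\<bar> *\<^sub>R (LINT x|lborel. f (t + \<delta> k * x) * (sqrt (2 * pi) / \<delta> k * exp (- ((t + \<delta> k * x - t) / \<delta> k)\<^sup>2 / 2)))"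
      by (rule lborel_integral_real_affine) (use \<delta>[of k] in auto)
    also have "(\<lambda>x. f (t + \<delta> k * x) * complex_of_real (sqrt (2 * pi) / \<delta> k * exp (- ((t + \<delta> k * x - t) / \<delta> k)\<^sup>2 / 2)))
      = (\<lambda>x. (2 * pi / \<delta> k) * (f (t + \<delta> k * x) * std_normal_density x))"
    proof
      fix x
      have "2 * pi / \<delta> k * std_normal_density x = (2 * pi / sqrt (2 * pi)) / \<delta> k * exp (- x\<^sup>2 / 2)"
        by (simp add: dens)
      also have "2 * pi / sqrt (2 * pi) = sqrt (2 * pi)" by (rule real_div_sqrt) simp
      also have "x = (t + \<delta> k * x - t) / \<delta> k" using \<delta>[of k] by simp
      finally have A: "sqrt (2 * pi) / \<delta> k * exp (- ((t + \<delta> k * x - t) / \<delta> k)\<^sup>2 / 2)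
          = 2 * pi / \<delta> k * std_normal_density x"
        using \<delta>[of k] by simp
      show "f (t + \<delta> k * x) * complex_of_real (sqrt (2 * pi) / \<delta> k * exp (- ((t + \<delta> k * x - t) / \<delta> k)\<^sup>2 / 2))
          = complex_of_real (2 * pi / \<delta> k) * (f (t + \<delta> k * x) * complex_of_real (std_normal_density x))"
        by (subst A) simp
    qed
    also have "\<bar>\<delta> k\<bar> *\<^sub>R (LINT x|lborel. complex_of_real (2 * pi / \<delta> k) * (f (t + \<delta> k * x) * complex_of_real (std_normal_density x)))
        = 2 * pi * (LINT x|lborel. f (t + \<delta> k * x) * std_normal_density x)"
      using \<delta>[of k] by (subst integral_mult_right_zero) (simp add: scaleR_conv_of_real)
    finally show ?thesis .
  qed
  have "(\<lambda>k. LINT \<tau>|lborel. F \<tau> * iexp (- (\<tau> * t)) * g k \<tau>) \<longlonglongrightarrow> (LINT \<tau>|lborel. F \<tau> * iexp (- (\<tau> * t)))"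
  proof (rule integral_dominated_convergence[where w = "\<lambda>\<tau>. norm (F \<tau>)"])
    show "AE \<tau> in lborel. (\<lambda>k. F \<tau> * iexp (- (\<tau> * t)) * g k \<tau>) \<longlonglongrightarrow> F \<tau> * iexp (- (\<tau> * t))"
    proof (rule AE_I2)
      fix \<tau>
      have "(\<lambda>k. g k \<tau>) \<longlonglongrightarrow> complex_of_real (exp (- (0 * \<tau>)\<^sup>2 / 2))"
        unfolding g_def by (intro tendsto_intros \<delta>0) auto
      then show "(\<lambda>k. F \<tau> * iexp (- (\<tau> * t)) * g k \<tau>) \<longlonglongrightarrow> F \<tau> * iexp (- (\<tau> * t))"
        using tendsto_mult[OF tendsto_const, of "\<lambda>k. g k \<tau>" 1 sequentially "F \<tau> * iexp (- (\<tau> * t))"] by simp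
    qed
    show "AE \<tau> in lborel. norm (F \<tau> * iexp (- (\<tau> * t)) * g k \<tau>) \<le> norm (F \<tau>)" for k
      by (intro AE_I2) (auto simp: norm_mult g_def intro!: mult_left_le)
  qed (use F in auto)
  \<comment> \<open>The bound \<open>B\<close> supplies the dominating function, and continuity at
    \<open>t\<close> the pointwise limit.\<close>
  moreover have "(\<lambda>k. LINT \<tau>|lborel. F \<tau> * iexp (- (\<tau> * t)) * g k \<tau>)
      \<longlonglongrightarrow> 2 * pi * (LINT x|lborel. f t * std_normal_density x)"
    unfolding eq
  proof (intro tendsto_mult tendsto_const,
      rule integral_dominated_convergence[where w = "\<lambda>x. B * std_normal_density x"])
    show "AE x in lborel. (\<lambda>k. f (t + \<delta> k * x) * std_normal_density x) \<longlonglongrightarrow> f t * std_normal_density x"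
    proof (intro AE_I2 tendsto_mult tendsto_const)
      fix x
      have "(\<lambda>k. t + \<delta> k * x) \<longlonglongrightarrow> t + 0 * x" by (intro tendsto_intros \<delta>0)
      then show "(\<lambda>k. f (t + \<delta> k * x)) \<longlonglongrightarrow> f t"
        by (intro isCont_tendsto_compose[OF cont]) simp
    qed
    show "AE x in lborel. norm (f (t + \<delta> k * x) * std_normal_density x) \<le> B * std_normal_density x" for k
      using B by (intro AE_I2) (auto simp: norm_mult less_imp_le intro!: mult_right_mono)
    show "integrable lborel (\<lambda>x. B * std_normal_density x)"
      using integrable_std_normal_moment[of 0] by simp
  qed auto
  moreover have "(LINT x|lborel. f t * complex_of_real (std_normal_density x)) = f t"
    using integral_std_normal_moment_even[of 0] by simp
  ultimately show ?thesis using LIMSEQ_unique by fastforce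
qed

text \<open>The image under \<open>exp\<close> of the measure with density \<open>exp t\<close> is
  Lebesgue measure on the half-line. This equality of measures yields integrability and value
  together, for vector-valued functions.\<close>

lemma lborel_integral_exp_subst:
  fixes g :: "real \<Rightarrow> 'a :: {banach, second_countable_topology}"
  assumes [measurable]: "g \<in> borel_measurable borel"
  shows "integrable lborel (\<lambda>x. indicator {0<..} x *\<^sub>R g x) \<longleftrightarrow> integrable lborel (\<lambda>t. exp t *\<^sub>R g (exp t))"
    and "(LINT x|lborel. indicator {0<..} x *\<^sub>R g x) = (LINT t|lborel. exp t *\<^sub>R g (exp t))"
proof -
  have eq: "distr (density lborel (\<lambda>t. ennreal (exp t))) borel exp
      = density lborel (\<lambda>x. ennreal (indicator {0<..} (x::real)))"
  proof (rule measure_eqI)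
    fix A assume "A \<in> sets (distr (density lborel (\<lambda>t::real. ennreal (exp t))) borel exp)"
    then have [measurable]: "A \<in> sets borel" by simp
    have [measurable]: "exp -` A \<in> sets borel"
      using measurable_sets[of "exp :: real \<Rightarrow> real" borel borel A] by simp
    have "emeasure (distr (density lborel (\<lambda>t::real. ennreal (exp t))) borel exp) A
      = (\<integral>\<^sup>+ t. indicator A (exp t) * ennreal (exp t) \<partial>lborel)"
      by (subst emeasure_distr, simp, simp, subst emeasure_density)
         (auto intro!: nn_integral_cong simp: indicator_def)
    also have "\<dots> = (\<integral>\<^sup>+ x. indicator A x * indicator {0<..} x \<partial>lborel)"
      by (rule nn_integral_exp_subst[symmetric]) measurable
    also have "\<dots> = emeasure (density lborel (\<lambda>x. ennreal (indicator {0<..} (x::real)))) A"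
      by (subst emeasure_density) (auto intro!: nn_integral_cong simp: indicator_def)
    finally show "emeasure (distr (density lborel (\<lambda>t::real. ennreal (exp t))) borel exp) A
      = emeasure (density lborel (\<lambda>x. ennreal (indicator {0<..} (x::real)))) A" .
  qed simp
  show "integrable lborel (\<lambda>x. indicator {0<..} x *\<^sub>R g x) \<longleftrightarrow> integrable lborel (\<lambda>t. exp t *\<^sub>R g (exp t))"
    using arg_cong[OF eq, of "\<lambda>M. integrable M g"]
    by (simp add: integrable_distr_eq integrable_density)
  show "(LINT x|lborel. indicator {0<..} x *\<^sub>R g x) = (LINT t|lborel. exp t *\<^sub>R g (exp t))"
    using arg_cong[OF eq, of "\<lambda>M. integral\<^sup>L M g"]
    by (simp add: integral_distr integral_density)
qed

text \<open>Euler's integral at \<open>u = exp s\<close>. On a vertical line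
  \<open>w = Complex a \<tau>\<close> it exhibits Gamma as the Fourier transform of exp (a s - exp
  s).\<close>

lemma Gamma_log_integral:
  assumes "Re w > 0"
  shows "has_bochner_integral lborel (\<lambda>s. exp (w * of_real s - of_real (exp s))) (Gamma w)"
proof -
  define f where "f u = exp ((w - 1) * complex_of_real (ln u)) * exp (- complex_of_real u)" for u
  have [measurable]: "f \<in> borel_measurable borel"
    unfolding f_def by measurable
  have f_eq: "of_real u powr (w - 1) / of_real (exp u) = f u" if "u \<in> {0<..}" for u :: real
    using that by (simp add: f_def powr_def Ln_of_real exp_minus field_simps exp_of_real)
  have abs: "set_integrable lebesgue {0<..} f"
    using absolutely_integrable_Gamma_integral'[OF assms]
    by (subst set_integrable_cong[OF refl refl f_eq[symmetric]])
  have "(f has_integral (LINT u:{0<..}|lebesgue. f u)) {0<..}"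
    by (rule has_integral_set_lebesgue[OF abs])
  moreover have "(f has_integral Gamma w) {0<..}"
    by (rule has_integral_eq[OF f_eq Gamma_integral_complex'[OF assms]])
  ultimately have G: "(LINT u:{0<..}|lebesgue. f u) = Gamma w" by (rule has_integral_unique)
  have f_exp: "exp s *\<^sub>R f (exp s) = exp (w * of_real s - of_real (exp s))" for s
    by (simp add: f_def scaleR_conv_of_real exp_of_real[symmetric] algebra_simps flip: exp_add)
  have "integrable lborel (\<lambda>x. indicator {0<..} x *\<^sub>R f x)"
    using abs unfolding set_integrable_def by (subst (asm) integrable_completion) auto
  moreover have "(LINT x|lborel. indicator {0<..} x *\<^sub>R f x) = Gamma w"
    using G unfolding set_lebesgue_integral_def by (subst (asm) integral_completion) auto
  ultimately show ?thesis
    by (simp add: lborel_integral_exp_subst f_exp has_bochner_integral_iff)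
qed

section \<open>The Gamma function on vertical lines\<close>

lemma norm_Gamma_le:
  assumes "Re w > 0"
  shows "norm (Gamma w) \<le> Gamma (Re w)"
proof -
  note h = Gamma_log_integral[OF assms]
  have h': "has_bochner_integral lborel (\<lambda>s. exp (complex_of_real (Re w) * of_real s - of_real (exp s)))
      (Gamma (complex_of_real (Re w)))"
    by (rule Gamma_log_integral) (use assms in simp)
  have eq: "exp (complex_of_real (Re w) * of_real s - of_real (exp s))
      = of_real (norm (exp (w * of_real s - of_real (exp s))))" for s
    by (simp flip: exp_of_real)
  have "norm (Gamma w) \<le> (LINT s|lborel. norm (exp (w * of_real s - of_real (exp s))))"
    using has_bochner_integral_integral_eq[OF h] integral_norm_bound by metis
  also have "complex_of_real \<dots> = Gamma (complex_of_real (Re w))"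
    using has_bochner_integral_integral_eq[OF h'] unfolding eq by simp
  then have "(LINT s|lborel. norm (exp (w * of_real s - of_real (exp s)))) = Gamma (Re w)"
    by (simp add: Gamma_complex_of_real)
  finally show ?thesis .
qed

lemma measurable_Gamma_vertical [measurable]:
  assumes "a > 0"
  shows "(\<lambda>\<tau>. Gamma (Complex a \<tau>)) \<in> borel_measurable borel"
proof -
  have "Gamma (Complex a \<tau>) = (LINT s|lborel. exp (Complex a \<tau> * of_real s - of_real (exp s)))" for \<tau>
    using has_bochner_integral_integral_eq[OF Gamma_log_integral[of "Complex a \<tau>"]] assms by simp
  then show ?thesis by (simp add: Complex_eq)
qed

text \<open>Two applications of the functional equation give
  \<open>Gamma (z + 2) = (z + 1) * z * Gamma z\<close>. The left side is bounded by
  \<open>Gamma (a + 2)\<close>, so Gamma decays at least like the inverse square of the height. The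
  factor \<open>max 1 (1 / a\<^sup>2)\<close> in \<open>C\<close> passes from
  \<open>a\<^sup>2 + \<tau>\<^sup>2\<close> to \<open>1 + \<tau>\<^sup>2\<close>.\<close>

lemma integrable_Gamma_vertical:
  assumes "a > 0"
  shows "integrable lborel (\<lambda>\<tau>. Gamma (Complex a \<tau>))"
proof -
  note [measurable] = measurable_Gamma_vertical[OF assms]
  define C where "C = Gamma (a + 2) * max 1 (1 / a\<^sup>2)"
  have "integrable lborel (\<lambda>\<tau>. C * inverse (1 + \<tau>\<^sup>2))"
    using integrable_inverse_1_plus_square by (simp add: set_integrable_def)
  then show ?thesis
  proof (rule Bochner_Integration.integrable_bound)
    show "AE \<tau> in lborel. norm (Gamma (Complex a \<tau>)) \<le> norm (C * inverse (1 + \<tau>\<^sup>2))"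
    proof (rule AE_I2)
      fix \<tau> :: real
      define z where "z = Complex a \<tau>"
      have z: "Re z > 0" using assms by (simp add: z_def)
      have "z \<notin> \<int>\<^sub>\<le>\<^sub>0" "z + 1 \<notin> \<int>\<^sub>\<le>\<^sub>0" using z by (auto elim!: nonpos_Ints_cases simp: complex_eq_iff)
      then have "Gamma (z + 2) = (z + 1) * (z * Gamma z)"
        using Gamma_plus1[of z] Gamma_plus1[of "z + 1"] by (simp add: add.assoc)
      then have "norm (Gamma (z + 2)) = norm (z + 1) * norm z * norm (Gamma z)"
        by (simp add: norm_mult)
      moreover have "norm (Gamma (z + 2)) \<le> Gamma (a + 2)"
        using norm_Gamma_le[of "z + 2"] assms by (simp add: z_def)
      moreover have "norm z \<le> norm (z + 1)"
        using assms by (auto simp: z_def cmod_def power2_eq_square algebra_simps)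
      then have "norm z * norm z * norm (Gamma z) \<le> norm (z + 1) * norm z * norm (Gamma z)"
        by (intro mult_right_mono) auto
      moreover have zz: "norm z * norm z = a\<^sup>2 + \<tau>\<^sup>2"
        by (simp add: z_def cmod_def)
      ultimately have le: "(a\<^sup>2 + \<tau>\<^sup>2) * norm (Gamma z) \<le> Gamma (a + 2)" by simp
      have "1 + \<tau>\<^sup>2 \<le> max 1 (1 / a\<^sup>2) * (a\<^sup>2 + \<tau>\<^sup>2)"
      proof -
        have "1 = 1 / a\<^sup>2 * a\<^sup>2" using assms by simp
        also have "\<dots> \<le> max 1 (1 / a\<^sup>2) * a\<^sup>2" by (intro mult_right_mono) auto
        finally have "1 \<le> max 1 (1 / a\<^sup>2) * a\<^sup>2" .
        moreover have "1 * \<tau>\<^sup>2 \<le> max 1 (1 / a\<^sup>2) * \<tau>\<^sup>2" by (intro mult_right_mono) auto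
        ultimately show ?thesis by (simp add: distrib_left)
      qed
      then have "(1 + \<tau>\<^sup>2) * norm (Gamma z) \<le> max 1 (1 / a\<^sup>2) * (a\<^sup>2 + \<tau>\<^sup>2) * norm (Gamma z)"
        by (intro mult_right_mono) auto
      also have "\<dots> \<le> max 1 (1 / a\<^sup>2) * Gamma (a + 2)"
        using le by (simp add: mult.assoc mult_left_mono)
      finally have "norm (Gamma z) \<le> C * inverse (1 + \<tau>\<^sup>2)"
        by (simp add: C_def field_simps add_pos_nonneg)
      then show "norm (Gamma (Complex a \<tau>)) \<le> norm (C * inverse (1 + \<tau>\<^sup>2))"
        unfolding z_def by (metis abs_ge_self order_trans real_norm_def)
    qed
  qed measurable
qed

text \<open>The factor \<open>exp (c * s)\<close> makes the seed integrable at -\<infinity>; Fourier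
  inversion is applied to the product, and the factor is divided out afterwards.\<close>

lemma Mellin_inversion_exp:
  assumes "c > 0"
  shows "(LINT \<tau>|lborel. Gamma (Complex c \<tau>) * exp (- (Complex c \<tau> * of_real t)))
    = 2 * pi * exp (- exp t)"
proof -
  define f where "f s = exp (complex_of_real c * of_real s - of_real (exp s))" for s
  have [measurable]: "f \<in> borel_measurable borel" unfolding f_def by measurable
  have fF: "(LINT s|lborel. f s * iexp (\<tau> * s)) = Gamma (Complex c \<tau>)" for \<tau>
  proof -
    have "(LINT s|lborel. f s * iexp (\<tau> * s)) = (LINT s|lborel. exp (Complex c \<tau> * of_real s - of_real (exp s)))"
      by (intro Bochner_Integration.integral_cong refl)
        (simp add: f_def Complex_eq algebra_simps flip: exp_add)
    also have "\<dots> = Gamma (Complex c \<tau>)"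
      by (rule has_bochner_integral_integral_eq[OF Gamma_log_integral]) (use assms in simp)
    finally show ?thesis .
  qed
  have int_f: "integrable lborel f"
    using Gamma_log_integral[of "of_real c"] assms unfolding f_def has_bochner_integral_iff by simp
  obtain n :: nat where n: "c \<le> real n" using real_arch_simple by blast
  have B: "norm (f s) \<le> fact n" for s
  proof -
    have nf: "norm (f s) = exp (c * s - exp s)" by (simp add: f_def)
    show ?thesis
    proof (cases "s \<ge> 0")
      case True
      have "exp (c * s) \<le> exp (real n * s)" using n True by (simp add: mult_right_mono)
      also have "\<dots> \<le> fact n * exp (exp s)"
        using power_le_fact_exp[of "exp s" n] by (simp add: exp_of_nat_mult)
      finally show ?thesis by (simp add: nf exp_diff divide_le_eq)
    next
      case False
      then have "c * s - exp s \<le> 0"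
        using assms exp_gt_zero[of s] mult_nonneg_nonpos[of c s] by linarith
      then have "exp (c * s - exp s) \<le> 1" by simp
      also have "1 \<le> (fact n :: real)" by (rule fact_ge_1)
      finally show ?thesis by (simp add: nf)
    qed
  qed
  have "(LINT \<tau>|lborel. (LINT s|lborel. f s * iexp (\<tau> * s)) * iexp (- (\<tau> * t))) = 2 * pi * f t"
  proof (rule fourier_inversion[OF int_f B])
    show "isCont f t" unfolding f_def by (intro continuous_intros)
    show "integrable lborel (\<lambda>\<tau>. LINT s|lborel. f s * iexp (\<tau> * s))"
      unfolding fF by (rule integrable_Gamma_vertical[OF assms])
  qed
  then have inv: "(LINT \<tau>|lborel. Gamma (Complex c \<tau>) * iexp (- (\<tau> * t))) = 2 * pi * f t"
    unfolding fF .
  have "(LINT \<tau>|lborel. Gamma (Complex c \<tau>) * exp (- (Complex c \<tau> * of_real t)))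
      = (LINT \<tau>|lborel. exp (- (of_real c * of_real t)) * (Gamma (Complex c \<tau>) * iexp (- (\<tau> * t))))"
    by (intro Bochner_Integration.integral_cong refl)
      (simp add: Complex_eq algebra_simps flip: exp_add)
  also have "\<dots> = exp (- (of_real c * of_real t)) * (2 * pi * f t)"
    by (subst integral_mult_right_zero) (simp only: inv)
  also have "\<dots> = 2 * pi * (exp (- (of_real c * of_real t)) * f t)"
    by simp
  also have "exp (- (of_real c * of_real t)) * f t = exp (- exp t)"
    by (simp add: f_def flip: exp_add exp_of_real)
  finally show ?thesis by simp
qed

section \<open>Mellin-Barnes representation of the limit function\<close>

lemma measurable_Gfun [measurable]: "Gfun m b \<in> borel_measurable borel"
proof -
  have [measurable]: "mconv (\<lambda>j. gker (b j)) m (gker 0) \<in> borel_measurable borel"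
    by measurable
  show ?thesis unfolding Gfun_def [abs_def] by measurable
qed

lemma Gfun_Suc: "Gfun (Suc m) b t
  = (LINT s|lborel. exp (b (Suc m) * s - exp s) * Gfun m b (t - s))"
proof -
  have "(LINT s|lborel. exp (b (Suc m) * s - exp s) * Gfun m b (t - s))
      = enn2real (\<integral>\<^sup>+ s. ennreal (exp (b (Suc m) * s - exp s) * Gfun m b (t - s)) \<partial>lborel)"
    by (rule integral_eq_nn_integral) (auto simp: Gfun_pos less_imp_le)
  also have "\<dots> = Gfun (Suc m) b t"
    unfolding Gfun_def[of "Suc m"] mconv.simps conv_def
    by (simp add: ennreal_mult' gker_def ennreal_Gfun)
  finally show ?thesis ..
qed

lemma Gamma_shift_vertical:
  "Gamma (complex_of_real a + Complex c \<tau>) = Gamma (Complex (a + c) \<tau>)"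
  by (simp add: Complex_eq add.assoc)

text \<open>Fourier inversion enters only in the base case. Each further Gamma factor is opened as
  the integral of its kernel, and Fubini turns multiplication by it into convolution. The new factor
  is bounded on the line, so integrability persists.\<close>

lemma Gfun_Mellin_Barnes:
  assumes c: "c > 0" and b: "\<And>j. j \<in> {1..m} \<Longrightarrow> b j + c > 0"
  defines "P \<equiv> \<lambda>m \<tau>. (\<Prod>j\<in>{1..m}. Gamma (of_real (b j) + Complex c \<tau>)) * Gamma (Complex c \<tau>)"
  shows "integrable lborel (P m) \<and> (\<forall>t. (LINT \<tau>|lborel. P m \<tau> * exp (- (Complex c \<tau> * of_real t)))
    = 2 * pi * Gfun m b t)"
  using b
proof (induction m)
  case 0
  show ?case
    using integrable_Gamma_vertical[OF c] Mellin_inversion_exp[OF c]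
    by (simp add: P_def Gfun_def gker_def)
next
  case (Suc m)
  define a where "a = b (Suc m)"
  have a: "a + c > 0" using Suc.prems[of "Suc m"] by (simp add: a_def)
  have IH: "integrable lborel (P m)"
    "\<And>t. (LINT \<tau>|lborel. P m \<tau> * exp (- (Complex c \<tau> * of_real t))) = 2 * pi * Gfun m b t"
    using Suc.IH Suc.prems by auto
  have PS: "P (Suc m) \<tau> = Gamma (Complex (a + c) \<tau>) * P m \<tau>" for \<tau>
    by (simp add: P_def prod.nat_ivl_Suc' a_def Gamma_shift_vertical)
  have [measurable]: "P m \<in> borel_measurable borel" using IH(1) by auto
  note [measurable] = measurable_Gamma_vertical[OF a]
  have int: "integrable lborel (P (Suc m))"
    unfolding PS
  proof (rule Bochner_Integration.integrable_bound[OF integrable_mult_right[OF IH(1), of "of_real (Gamma (a + c))"]])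
    show "AE \<tau> in lborel. norm (Gamma (Complex (a + c) \<tau>) * P m \<tau>) \<le> norm (of_real (Gamma (a + c)) * P m \<tau>)"
      using norm_Gamma_le[of "Complex (a + c) _"] a Gamma_real_pos[OF a]
      by (intro AE_I2) (auto simp: norm_mult intro!: mult_right_mono)
  qed measurable
  have "(LINT \<tau>|lborel. P (Suc m) \<tau> * exp (- (Complex c \<tau> * of_real t))) = 2 * pi * Gfun (Suc m) b t" for t
  proof -
    define k where "k s = exp (a * s - exp s)" for s
    define h where "h \<tau> s = P m \<tau> * exp (- (Complex c \<tau> * of_real (t - s))) * of_real (k s)" for \<tau> s
    have [measurable]: "k \<in> borel_measurable borel" unfolding k_def by measurable
    have int_k: "integrable lborel (\<lambda>s. exp ((a + c) * s - exp s) :: real)"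
    proof -
      have "integrable lborel (\<lambda>s. exp (of_real (a + c) * of_real s - of_real (exp s)) :: complex)"
        using Gamma_log_integral[of "of_real (a + c)"] a unfolding has_bochner_integral_iff by simp
      from integrable_norm[OF this] show ?thesis by simp
    qed
    have norm_h: "norm (h \<tau> s) = norm (P m \<tau>) * exp (- (c * t)) * exp ((a + c) * s - exp s)" for \<tau> s
      by (simp add: h_def k_def norm_mult algebra_simps flip: exp_add)
    have "2 * pi * complex_of_real (Gfun (Suc m) b t)
        = 2 * pi * (LINT s|lborel. complex_of_real (k s * Gfun m b (t - s)))"
      unfolding Gfun_Suc integral_complex_of_real by (simp add: k_def a_def)
    also have "\<dots> = (LINT s|lborel. (2 * pi * Gfun m b (t - s)) * complex_of_real (k s))"
      by (subst integral_mult_right_zero[symmetric]) (simp add: mult_ac)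
    also have "\<dots> = (LINT s|lborel. LINT \<tau>|lborel. h \<tau> s)"
      unfolding h_def by (simp only: integral_mult_left_zero IH(2))
    also have "\<dots> = (LINT \<tau>|lborel. LINT s|lborel. h \<tau> s)"
    proof (rule lborel_pair.Fubini_integral, rule lborel_pair.Fubini_integrable)
      show "(\<lambda>(\<tau>, s). h \<tau> s) \<in> borel_measurable (lborel \<Otimes>\<^sub>M lborel)"
        unfolding h_def Complex_eq by measurable
      show "integrable lborel (\<lambda>\<tau>. LINT s|lborel. norm (case (\<tau>, s) of (\<tau>, s) \<Rightarrow> h \<tau> s))"
        using IH(1) by (simp add: norm_h)
      show "AE \<tau> in lborel. integrable lborel (\<lambda>s. case (\<tau>, s) of (\<tau>, s) \<Rightarrow> h \<tau> s)"
      proof (rule AE_I2)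
        fix \<tau>
        show "integrable lborel (\<lambda>s. case (\<tau>, s) of (\<tau>, s) \<Rightarrow> h \<tau> s)"
        proof (rule Bochner_Integration.integrable_bound)
          show "integrable lborel (\<lambda>s. norm (P m \<tau>) * exp (- (c * t)) * exp ((a + c) * s - exp s))"
            using int_k by simp
          show "(\<lambda>s. case (\<tau>, s) of (\<tau>, s) \<Rightarrow> h \<tau> s) \<in> borel_measurable lborel"
            unfolding h_def prod.case by measurable
        qed (auto simp: norm_h)
      qed
    qed
    also have "\<dots> = (LINT \<tau>|lborel. P (Suc m) \<tau> * exp (- (Complex c \<tau> * of_real t)))"
    proof (intro Bochner_Integration.integral_cong refl)
      fix \<tau>
      have "(LINT s|lborel. h \<tau> s) = (LINT s|lborel. P m \<tau> * exp (- (Complex c \<tau> * of_real t))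
          * exp (Complex (a + c) \<tau> * of_real s - of_real (exp s)))"
        by (intro Bochner_Integration.integral_cong refl)
          (simp add: h_def k_def Complex_eq algebra_simps exp_of_real[symmetric] mult.assoc flip: exp_add)
      also have "\<dots> = P m \<tau> * exp (- (Complex c \<tau> * of_real t)) * Gamma (Complex (a + c) \<tau>)"
        using has_bochner_integral_integral_eq[OF Gamma_log_integral[of "Complex (a + c) \<tau>"]] a
        by simp
      finally show "(LINT s|lborel. h \<tau> s) = P (Suc m) \<tau> * exp (- (Complex c \<tau> * of_real t))"
        by (simp add: PS mult_ac)
    qed
    finally show ?thesis by simp
  qed
  with int show ?case by blast
qed

lemma meijer_G_eq_Gfun:
  assumes n: "n \<ge> 1" and bn: "b n = 0" and b: "\<And>j. j \<in> {1..n} \<Longrightarrow> b j + c > 0" and x: "x > 0"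
  shows "meijer_G_n0_0n c n b x = of_real (Gfun (n - 1) b (ln x))"
proof -
  define m where "m = n - 1"
  have nm: "n = Suc m" using n by (simp add: m_def)
  have c: "c > 0" using b[of n] bn n by simp
  have "(LINT t|lborel. (\<Prod>j\<in>{1..n}. Gamma (of_real (b j) + Complex c t))
          * of_real x powr (- Complex c t) * \<i>)
    = (LINT t|lborel. (\<Prod>j\<in>{1..m}. Gamma (of_real (b j) + Complex c t)) * Gamma (Complex c t)
          * exp (- (Complex c t * of_real (ln x)))) * \<i>"
    using bn x by (subst integral_mult_left_zero[symmetric])
      (simp add: nm prod.nat_ivl_Suc' powr_def Ln_of_real mult_ac)
  also have "\<dots> = 2 * pi * Gfun m b (ln x) * \<i>"
    using Gfun_Mellin_Barnes[of c m b] c b by (simp add: nm)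
  finally show ?thesis unfolding meijer_G_n0_0n_def by (simp add: m_def)
qed

section \<open>The weight in logarithmic coordinates\<close>

text \<open>For \<open>s = ln (L * y\<^sup>2)\<close> one has ds = (2 / y) dy.\<close>

lemma nn_integral_log_square_subst:
  fixes g :: "real \<Rightarrow> ennreal"
  assumes [measurable]: "g \<in> borel_measurable borel" and L: "L > 0"
  shows "(\<integral>\<^sup>+ y. g (ln (L * y\<^sup>2)) * indicator {0<..} y * ennreal (2 / y) \<partial>lborel) = (\<integral>\<^sup>+ s. g s \<partial>lborel)"
proof -
  have "(\<integral>\<^sup>+ y. g (ln (L * y\<^sup>2)) * indicator {0<..} y * ennreal (2 / y) \<partial>lborel)
      = (\<integral>\<^sup>+ y. g (ln (L * y\<^sup>2)) * ennreal (2 / y) * indicator {0<..} y \<partial>lborel)"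
    by (simp add: mult_ac)
  also have "\<dots> = (\<integral>\<^sup>+ u. g (ln (L * (exp u)\<^sup>2)) * ennreal (2 / exp u) * ennreal (exp u) \<partial>lborel)"
    by (rule nn_integral_exp_subst) measurable
  also have "\<dots> = (\<integral>\<^sup>+ u. ennreal 2 * g (ln L + 2 * u) \<partial>lborel)"
  proof (rule nn_integral_cong)
    fix u
    have "ln (L * (exp u)\<^sup>2) = ln L + 2 * u" using L by (simp add: ln_mult ln_realpow)
    moreover have "ennreal (2 / exp u) * ennreal (exp u) = ennreal 2"
      by (subst ennreal_mult[symmetric]) auto
    ultimately show "g (ln (L * (exp u)\<^sup>2)) * ennreal (2 / exp u) * ennreal (exp u) = ennreal 2 * g (ln L + 2 * u)"
      by (simp only: mult.assoc) (rule mult.commute)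
  qed
  also have "\<dots> = ennreal 2 * (\<integral>\<^sup>+ u. g (ln L + 2 * u) \<partial>lborel)"
    by (rule nn_integral_cmult) measurable
  also have "\<dots> = (\<integral>\<^sup>+ s. g s \<partial>lborel)"
    by (subst nn_integral_real_affine[of g 2 "ln L"]) auto
  finally show ?thesis .
qed

text \<open>In the variables \<open>s j = ln (L * (r j)\<^sup>2)\<close> the last factor receives
  what remains of \<open>t\<close>, and integrating the coordinates one at a time is iterated
  convolution.\<close>

lemma nn_integral_PiM_mconv:
  assumes [measurable]: "\<And>j. k j \<in> borel_measurable borel" "h \<in> borel_measurable borel"
    and L: "L > 0"
  shows "(\<integral>\<^sup>+ r. h (t - (\<Sum>j\<in>{1..m}. ln (L * (r j)\<^sup>2)))
      * (\<Prod>j\<in>{1..m}. k j (ln (L * (r j)\<^sup>2)) * indicator {0<..} (r j) * ennreal (2 / r j))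
        \<partial>(\<Pi>\<^sub>M j\<in>{1..m}. lborel)) = mconv k m h t"
proof (induction m arbitrary: t)
  case 0
  show ?case by (simp add: PiM_empty nn_integral_count_space_finite)
next
  case (Suc m)
  interpret product_sigma_finite "\<lambda>_::nat. lborel :: real measure" by standard
  define I where "I = {1..m}"
  have I: "finite I" "Suc m \<notin> I" "{1..Suc m} = insert (Suc m) I" by (auto simp: I_def)
  have [measurable]: "mconv k m h \<in> borel_measurable borel" by measurable
  define \<phi> where "\<phi> j y = k j (ln (L * y\<^sup>2)) * indicator {0<..} y * ennreal (2 / y)" for j y
  have [measurable]: "\<phi> j \<in> borel_measurable borel" for j unfolding \<phi>_def by measurable
  have upd: "(\<Sum>j\<in>insert (Suc m) I. ln (L * ((r(Suc m := y)) j)\<^sup>2)) = ln (L * y\<^sup>2) + (\<Sum>j\<in>I. ln (L * (r j)\<^sup>2))"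
    "(\<Prod>j\<in>insert (Suc m) I. \<phi> j ((r(Suc m := y)) j)) = \<phi> (Suc m) y * (\<Prod>j\<in>I. \<phi> j (r j))" for r y
    using I by (auto intro!: sum.cong prod.cong arg_cong2[where f = "(+)"] arg_cong2[where f = "(*)"])
  have "(\<integral>\<^sup>+ r. h (t - (\<Sum>j\<in>insert (Suc m) I. ln (L * (r j)\<^sup>2))) * (\<Prod>j\<in>insert (Suc m) I. \<phi> j (r j))
        \<partial>(\<Pi>\<^sub>M j\<in>insert (Suc m) I. lborel))
    = (\<integral>\<^sup>+ y. \<integral>\<^sup>+ r. h (t - (\<Sum>j\<in>insert (Suc m) I. ln (L * ((r(Suc m := y)) j)\<^sup>2)))
        * (\<Prod>j\<in>insert (Suc m) I. \<phi> j ((r(Suc m := y)) j)) \<partial>(\<Pi>\<^sub>M j\<in>I. lborel) \<partial>lborel)"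
    by (rule product_nn_integral_insert_rev) (use I in measurable)
  also have "\<dots> = (\<integral>\<^sup>+ y. k (Suc m) (ln (L * y\<^sup>2)) * mconv k m h (t - ln (L * y\<^sup>2))
      * indicator {0<..} y * ennreal (2 / y) \<partial>lborel)"
  proof (rule nn_integral_cong)
    fix y
    have "(\<integral>\<^sup>+ r. h (t - (\<Sum>j\<in>insert (Suc m) I. ln (L * ((r(Suc m := y)) j)\<^sup>2)))
        * (\<Prod>j\<in>insert (Suc m) I. \<phi> j ((r(Suc m := y)) j)) \<partial>(\<Pi>\<^sub>M j\<in>I. lborel))
      = (\<integral>\<^sup>+ r. \<phi> (Suc m) y * (h (t - ln (L * y\<^sup>2) - (\<Sum>j\<in>I. ln (L * (r j)\<^sup>2))) * (\<Prod>j\<in>I. \<phi> j (r j))) \<partial>(\<Pi>\<^sub>M j\<in>I. lborel))"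
      unfolding upd by (simp add: diff_diff_eq mult_ac)
    also have "\<dots> = \<phi> (Suc m) y * (\<integral>\<^sup>+ r. h (t - ln (L * y\<^sup>2) - (\<Sum>j\<in>I. ln (L * (r j)\<^sup>2))) * (\<Prod>j\<in>I. \<phi> j (r j)) \<partial>(\<Pi>\<^sub>M j\<in>I. lborel))"
      by (rule nn_integral_cmult) measurable
    also have "\<dots> = \<phi> (Suc m) y * mconv k m h (t - ln (L * y\<^sup>2))"
      unfolding \<phi>_def I_def Suc.IH ..
    finally show "(\<integral>\<^sup>+ r. h (t - (\<Sum>j\<in>insert (Suc m) I. ln (L * ((r(Suc m := y)) j)\<^sup>2)))
        * (\<Prod>j\<in>insert (Suc m) I. \<phi> j ((r(Suc m := y)) j)) \<partial>(\<Pi>\<^sub>M j\<in>I. lborel))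
      = k (Suc m) (ln (L * y\<^sup>2)) * mconv k m h (t - ln (L * y\<^sup>2)) * indicator {0<..} y * ennreal (2 / y)"
      by (simp add: \<phi>_def mult_ac)
  qed
  also have "\<dots> = (\<integral>\<^sup>+ s. k (Suc m) s * mconv k m h (t - s) \<partial>lborel)"
    by (rule nn_integral_log_square_subst[OF _ L]) measurable
  finally show ?case unfolding I(3) \<phi>_def by (simp only: mconv.simps conv_def)
qed

lemma power_int_eq_powr: "x > 0 \<Longrightarrow> x powi i = x powr real_of_int i"
  by (simp add: powr_real_of_int')

text \<open>The scaled argument contributes \<open>N ^ n\<close> in the denominator and the
  \<open>m\<close> radii take up \<open>N ^ m\<close>, so the last factor retains a single
  \<open>N\<close>, like all the others. Each radius contributes 1/2 from its Jacobian, turning 2 pi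
  into pi, and \<open>N powr (- b j)\<close>. With the power \<open>n * \<nu> n\<close> from the
  prefactor the exponents of \<open>N\<close> add up to the sum of the
  \<open>\<nu> i\<close>.\<close>

lemma prod_weight_eq_Wfun:
  fixes \<nu> :: "nat \<Rightarrow> int"
  assumes n: "n = Suc m" and N: "N > 0" and z: "z \<noteq> 0"
  shows "prod_weight n \<nu> N (z / of_real (real N powr (real n / 2)))
    = pi ^ m / real N powi (\<Sum>i\<in>{1..n}. \<nu> i) * cmod z powi (2 * \<nu> n)
      * enn2real (Wfun m (\<lambda>j. real_of_int (\<nu> j - \<nu> n)) (\<nu> n) N (ln ((cmod z)\<^sup>2)))"
proof -
  define b where "b j = real_of_int (\<nu> j - \<nu> n)" for j
  define d where "d = real_of_int (\<nu> n)"
  define L where "L = real N"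
  define t where "t = ln ((cmod z)\<^sup>2)"
  define w where "w = cmod (z / of_real (real N powr (real n / 2)))"
  have L: "L > 0" using N by (simp add: L_def)
  have w: "w = cmod z / L powr (real n / 2)" by (simp add: w_def L_def norm_divide)
  have w0: "w > 0" using z L by (simp add: w)
  have w2: "w\<^sup>2 = exp t / L ^ n"
  proof -
    have "(L powr (real n / 2))\<^sup>2 = L ^ n"
      using L by (simp add: powr_powr[symmetric] powr_realpow power2_eq_square flip: powr_add)
    then show ?thesis using z by (simp add: w t_def power_divide)
  qed
  define q where "q j = real N + (b j + d + 1)" for j
  define h where "h s = exp (0 * s) * (1 + exp s / L) powr (- (real N + (d + 1)))" for s
  define k where "k j s = exp (b j * s) * (1 + exp s / L) powr (- q j)" for j s
  define C where "C = w powi (2 * \<nu> n) * (\<Prod>j\<in>{1..m}. L powr (- b j) / 2)"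
  have C: "C \<ge> 0" using w0 unfolding C_def by (auto intro!: mult_nonneg_nonneg prod_nonneg)
  have h_pos: "h s \<ge> 0" and k_pos: "k j s \<ge> 0" for j s unfolding h_def k_def by auto
  have factor_pos: "k j s * indicator {0<..} y * (2 / y) \<ge> 0" for j s and y :: real
    using k_pos by (cases "y > 0") auto
  have [measurable]: "h \<in> borel_measurable borel" "k j \<in> borel_measurable borel" for j
    unfolding h_def k_def by measurable
  define M where "M = (\<Pi>\<^sub>M j\<in>{1..m}. lborel :: real measure)"
  have set: "{1..<n} = {1..m}" by (auto simp: n)
  have integrand: "indicator (\<Pi>\<^sub>E j\<in>{1..m}. {0<..}) r *\<^sub>R
        (w powi (2 * \<nu> n) / (1 + w\<^sup>2 / (\<Prod>j\<in>{1..m}. (r j)\<^sup>2)) powi (\<nu> n + int N + 1)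
        * (\<Prod>j\<in>{1..m}. r j powi (2 * \<nu> j - 2 * \<nu> n - 1) / (1 + (r j)\<^sup>2) powi (\<nu> j + int N + 1)))
      = C * (h (t - (\<Sum>j\<in>{1..m}. ln (L * (r j)\<^sup>2)))
        * (\<Prod>j\<in>{1..m}. k j (ln (L * (r j)\<^sup>2)) * indicator {0<..} (r j) * (2 / r j)))"
    (is "?lhs = ?rhs") if r: "r \<in> space M" for r
  proof (cases "\<forall>j\<in>{1..m}. r j > 0")
    case False
    then obtain j where j: "j \<in> {1..m}" "\<not> r j > 0" by blast
    then have "(\<Prod>j\<in>{1..m}. k j (ln (L * (r j)\<^sup>2)) * indicator {0<..} (r j) * (2 / r j)) = 0"
      by (intro prod_zero) (auto intro!: bexI[of _ j])
    moreover have "r \<notin> (\<Pi>\<^sub>E j\<in>{1..m}. {0<..})" using j by auto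
    ultimately show ?thesis by simp
  next
    case True
    have mem: "r \<in> (\<Pi>\<^sub>E j\<in>{1..m}. {0<..})"
      using True r by (auto simp: M_def space_PiM PiE_def Pi_def extensional_def)
    have exp_s: "exp (t - (\<Sum>j\<in>{1..m}. ln (L * (r j)\<^sup>2))) / L = w\<^sup>2 / (\<Prod>j\<in>{1..m}. (r j)\<^sup>2)"
    proof -
      have "exp (\<Sum>j\<in>{1..m}. ln (L * (r j)\<^sup>2)) = (\<Prod>j\<in>{1..m}. L * (r j)\<^sup>2)"
        using True L by (subst exp_sum) (auto intro!: prod.cong mult_pos_pos)
      also have "\<dots> = L ^ m * (\<Prod>j\<in>{1..m}. (r j)\<^sup>2)" by (simp add: prod.distrib)
      finally show ?thesis using L by (simp add: exp_diff w2 n field_simps)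
    qed
    have pos: "1 + w\<^sup>2 / (\<Prod>j\<in>{1..m}. (r j)\<^sup>2) > 0"
      by (intro add_pos_nonneg divide_nonneg_nonneg prod_nonneg) auto
    have hh: "h (t - (\<Sum>j\<in>{1..m}. ln (L * (r j)\<^sup>2)))
        = 1 / (1 + w\<^sup>2 / (\<Prod>j\<in>{1..m}. (r j)\<^sup>2)) powi (\<nu> n + int N + 1)"
    proof -
      have e: "real_of_int (\<nu> n + int N + 1) = real N + (d + 1)" by (simp add: d_def)
      show ?thesis
        unfolding h_def exp_s power_int_eq_powr[OF pos] powr_minus_divide e by simp
    qed
    have kk: "L powr (- b j) / 2 * (k j (ln (L * (r j)\<^sup>2)) * indicator {0<..} (r j) * (2 / r j))
        = r j powi (2 * \<nu> j - 2 * \<nu> n - 1) / (1 + (r j)\<^sup>2) powi (\<nu> j + int N + 1)"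
      if j: "j \<in> {1..m}" for j
    proof -
      have rj: "r j > 0" using True j by blast
      have p1: "1 + (r j)\<^sup>2 > 0" by (intro add_pos_nonneg) auto
      have e1: "exp (b j * ln (L * (r j)\<^sup>2)) = L powr b j * r j powr (2 * b j)"
        using L rj by (simp add: powr_def ln_mult ln_realpow algebra_simps flip: exp_add)
      have e2: "exp (ln (L * (r j)\<^sup>2)) / L = (r j)\<^sup>2" using L rj by simp
      have e3: "r j powr (2 * b j - 1) = r j powr (2 * b j) / r j"
        using rj by (simp add: powr_diff)
      have e4: "real_of_int (2 * \<nu> j - 2 * \<nu> n - 1) = 2 * b j - 1"
        "real_of_int (\<nu> j + int N + 1) = q j" by (simp_all add: b_def q_def d_def)
      show ?thesis
        unfolding k_def e1 e2 power_int_eq_powr[OF rj] power_int_eq_powr[OF p1] e3 e4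
        using rj L by (simp add: powr_minus field_simps)
    qed
    have "(\<Prod>j\<in>{1..m}. r j powi (2 * \<nu> j - 2 * \<nu> n - 1) / (1 + (r j)\<^sup>2) powi (\<nu> j + int N + 1))
      = (\<Prod>j\<in>{1..m}. L powr (- b j) / 2 * (k j (ln (L * (r j)\<^sup>2)) * indicator {0<..} (r j) * (2 / r j)))"
      using kk by (intro prod.cong) auto
    also have "\<dots> = (\<Prod>j\<in>{1..m}. L powr (- b j) / 2)
        * (\<Prod>j\<in>{1..m}. k j (ln (L * (r j)\<^sup>2)) * indicator {0<..} (r j) * (2 / r j))"
      by (rule prod.distrib)
    finally show ?thesis using mem unfolding hh C_def by simp
  qed
  have "prod_weight n \<nu> N (z / of_real (real N powr (real n / 2)))
    = (2 * pi) ^ m * (LINT r|M. C * (h (t - (\<Sum>j\<in>{1..m}. ln (L * (r j)\<^sup>2)))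
        * (\<Prod>j\<in>{1..m}. k j (ln (L * (r j)\<^sup>2)) * indicator {0<..} (r j) * (2 / r j))))"
    unfolding prod_weight_def set_lebesgue_integral_def set M_def[symmetric] w_def[symmetric]
    using Bochner_Integration.integral_cong[OF refl integrand, of M] by (simp add: n)
  also have "(LINT r|M. C * (h (t - (\<Sum>j\<in>{1..m}. ln (L * (r j)\<^sup>2)))
        * (\<Prod>j\<in>{1..m}. k j (ln (L * (r j)\<^sup>2)) * indicator {0<..} (r j) * (2 / r j))))
    = enn2real (\<integral>\<^sup>+ r. ennreal (C * (h (t - (\<Sum>j\<in>{1..m}. ln (L * (r j)\<^sup>2)))
        * (\<Prod>j\<in>{1..m}. k j (ln (L * (r j)\<^sup>2)) * indicator {0<..} (r j) * (2 / r j)))) \<partial>M)"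
  \<comment> \<open>Were the integral infinite, both sides would be 0. Finiteness is supplied later
    by the upper bound on \<open>Wfun\<close>.\<close>
  proof (rule integral_eq_nn_integral)
    show "AE r in M. 0 \<le> C * (h (t - (\<Sum>j\<in>{1..m}. ln (L * (r j)\<^sup>2)))
        * (\<Prod>j\<in>{1..m}. k j (ln (L * (r j)\<^sup>2)) * indicator {0<..} (r j) * (2 / r j)))"
      by (intro AE_I2 mult_nonneg_nonneg[OF C] mult_nonneg_nonneg[OF h_pos] prod_nonneg factor_pos)
  qed (unfold M_def, measurable)
  also have "(\<integral>\<^sup>+ r. ennreal (C * (h (t - (\<Sum>j\<in>{1..m}. ln (L * (r j)\<^sup>2)))
        * (\<Prod>j\<in>{1..m}. k j (ln (L * (r j)\<^sup>2)) * indicator {0<..} (r j) * (2 / r j)))) \<partial>M)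
    = (\<integral>\<^sup>+ r. ennreal C * (wker 0 (real N + (d + 1)) L (t - (\<Sum>j\<in>{1..m}. ln (L * (r j)\<^sup>2)))
        * (\<Prod>j\<in>{1..m}. wker (b j) (q j) L (ln (L * (r j)\<^sup>2)) * indicator {0<..} (r j) * ennreal (2 / r j))) \<partial>M)"
  proof (rule nn_integral_cong)
    fix r
    have w0_eq: "wker 0 (real N + (d + 1)) L s = ennreal (h s)" for s
      by (simp only: wker_def h_def)
    have e: "ennreal (k j (ln (L * (r j)\<^sup>2)) * indicator {0<..} (r j) * (2 / r j))
        = wker (b j) (q j) L (ln (L * (r j)\<^sup>2)) * indicator {0<..} (r j) * ennreal (2 / r j)" for j
    proof (cases "r j > 0")
      case True
      have "ennreal (k j (ln (L * (r j)\<^sup>2)) * (2 / r j)) = wker (b j) (q j) L (ln (L * (r j)\<^sup>2)) * ennreal (2 / r j)"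
        unfolding wker_def k_def[symmetric] using True by (intro ennreal_mult k_pos) simp
      then show ?thesis using True by simp
    qed simp
    have e': "ennreal (\<Prod>j\<in>{1..m}. k j (ln (L * (r j)\<^sup>2)) * indicator {0<..} (r j) * (2 / r j))
      = (\<Prod>j\<in>{1..m}. ennreal (k j (ln (L * (r j)\<^sup>2)) * indicator {0<..} (r j) * (2 / r j)))"
      by (rule prod_ennreal[symmetric]) (rule factor_pos)
    show "ennreal (C * (h (t - (\<Sum>j\<in>{1..m}. ln (L * (r j)\<^sup>2)))
        * (\<Prod>j\<in>{1..m}. k j (ln (L * (r j)\<^sup>2)) * indicator {0<..} (r j) * (2 / r j))))
      = ennreal C * (wker 0 (real N + (d + 1)) L (t - (\<Sum>j\<in>{1..m}. ln (L * (r j)\<^sup>2)))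
        * (\<Prod>j\<in>{1..m}. wker (b j) (q j) L (ln (L * (r j)\<^sup>2)) * indicator {0<..} (r j) * ennreal (2 / r j)))"
      by (simp only: w0_eq e[symmetric] e'[symmetric] ennreal_mult'[OF C] ennreal_mult'[OF h_pos])
  qed
  also have "\<dots> = ennreal C * (\<integral>\<^sup>+ r. wker 0 (real N + (d + 1)) L (t - (\<Sum>j\<in>{1..m}. ln (L * (r j)\<^sup>2)))
        * (\<Prod>j\<in>{1..m}. wker (b j) (q j) L (ln (L * (r j)\<^sup>2)) * indicator {0<..} (r j) * ennreal (2 / r j)) \<partial>M)"
    unfolding M_def by (rule nn_integral_cmult) measurable
  also have "\<dots> = ennreal C * Wfun m b d N t"
    unfolding M_def Wfun_def q_def L_def[symmetric]
    by (subst nn_integral_PiM_mconv[OF _ _ L]) auto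
  also have "enn2real (ennreal C * Wfun m b d N t) = C * enn2real (Wfun m b d N t)"
    using C by (simp add: enn2real_mult)
  finally have main: "prod_weight n \<nu> N (z / of_real (real N powr (real n / 2)))
    = (2 * pi) ^ m * C * enn2real (Wfun m b d N t)" by simp
  have "(2 * pi) ^ m * C = pi ^ m / real N powi (\<Sum>i\<in>{1..n}. \<nu> i) * cmod z powi (2 * \<nu> n)"
  proof -
    have prod_L: "(\<Prod>j\<in>{1..m}. L powr (- b j) / 2) = L powr (- (\<Sum>j\<in>{1..m}. b j)) / 2 ^ m"
      using L by (simp add: prod_dividef powr_sum sum_negf[symmetric])
    have w_powi: "w powi (2 * \<nu> n) = cmod z powi (2 * \<nu> n) / L powr (real n * d)"
    proof -
      have "(L powr (real n / 2)) powi (2 * \<nu> n) = L powr (real n * d)"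
        using L by (simp add: power_int_eq_powr powr_powr d_def)
      then show ?thesis by (simp add: w power_int_divide_distrib)
    qed
    have N_powi: "real N powi (\<Sum>i\<in>{1..n}. \<nu> i) = L powr (real n * d) * L powr (\<Sum>j\<in>{1..m}. b j)"
    proof -
      have "real_of_int (\<Sum>i\<in>{1..n}. \<nu> i) = real n * d + (\<Sum>j\<in>{1..m}. b j)"
        by (simp add: n b_def d_def sum_subtractf algebra_simps)
      then show ?thesis using L by (simp add: power_int_eq_powr L_def powr_add)
    qed
    show ?thesis
      unfolding C_def prod_L w_powi N_powi
      unfolding powr_minus_divide power_mult_distrib by simp
  qed
  then show ?thesis unfolding main b_def[abs_def] d_def t_def by (simp only:)
qed

text \<open>The product with a principal filter expresses uniformity: a single threshold for
  \<open>N\<close> serves all nonzero \<open>z\<close> in \<open>K\<close>. The prefactors on the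
  two sides agree exactly, so only the quotient of \<open>Wfun\<close> and \<open>Gfun\<close> has
  to be estimated.\<close>

theorem proposition3p2:
  fixes n :: nat and \<nu> :: "nat \<Rightarrow> int" and K :: "complex set" and c :: real
  assumes "n \<ge> 1"
    and "\<nu> 1 = 0" and "mono_on {1..n} \<nu>"
    and "compact K"
    and "c > - Min ((\<lambda>j. real_of_int (\<nu> j - \<nu> n)) ` {1..n})"
  defines "\<alpha> \<equiv> (\<Sum>i\<in>{1..n}. \<nu> i)"
  shows "(\<lambda>(N, z). complex_of_real
             (prod_weight n \<nu> N (z / of_real (real N powr (real n / 2)))))
         \<sim>[sequentially \<times>\<^sub>F principal (K - {0})]
         (\<lambda>(N, z). of_real (pi ^ (n - 1) / real N powi \<alpha> * cmod z powi (2 * \<nu> n))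
             * meijer_G_n0_0n c n (\<lambda>j. real_of_int (\<nu> j - \<nu> n)) ((cmod z)\<^sup>2))"
proof -
  define m where "m = n - 1"
  have n: "n = Suc m" using assms(1) by (simp add: m_def)
  define b where "b j = real_of_int (\<nu> j - \<nu> n)" for j
  define d where "d = real_of_int (\<nu> n)"
  have le: "\<nu> i \<le> \<nu> j" if "i \<in> {1..n}" "j \<in> {1..n}" "i \<le> j" for i j
    using assms(3) that by (auto simp: mono_on_def)
  have \<nu>0: "\<nu> j \<ge> 0" if "j \<in> {1..n}" for j
    using le[of 1 j] that assms(1,2) by auto
  have b: "b j \<le> 0 \<and> b j + d \<ge> 0 \<and> b j \<in> \<int>" if "j \<in> {1..m}" for j
    using le[of j n] \<nu>0[of j] that by (auto simp: b_def d_def n)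
  have d: "d \<ge> 0" using \<nu>0[of n] assms(1) by (simp add: d_def)
  have bc: "b j + c > 0" if "j \<in> {1..n}" for j
  proof -
    have "Min ((\<lambda>j. real_of_int (\<nu> j - \<nu> n)) ` {1..n}) \<le> b j"
      unfolding b_def using that by (intro Min_le) auto
    then show ?thesis using assms(5) by linarith
  qed
  obtain R where R: "\<And>z. z \<in> K \<Longrightarrow> cmod z \<le> R"
    using compact_imp_bounded[OF assms(4)] by (auto simp: bounded_iff)
  \<comment> \<open>Boundedness of \<open>K\<close> bounds \<open>t\<close> from above only, as 0
    may be a limit point; this is why both comparisons hold on a half-line
    \<open>t \<le> T\<close>.\<close>
  define T where "T = ln ((max 1 R)\<^sup>2)"
  have T: "ln ((cmod z)\<^sup>2) \<le> T" if "z \<in> K - {0}" for z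
  proof -
    have "cmod z \<le> max 1 R" using R that by force
    then have "(cmod z)\<^sup>2 \<le> (max 1 R)\<^sup>2" by (intro power_mono) auto
    then show ?thesis unfolding T_def using that by (intro ln_mono) auto
  qed
  define A where "A N z = pi ^ (n - 1) / real N powi \<alpha> * cmod z powi (2 * \<nu> n)" for N z
  have lhs: "prod_weight n \<nu> N (z / of_real (real N powr (real n / 2)))
      = A N z * enn2real (Wfun m b d N (ln ((cmod z)\<^sup>2)))" if "N > 0" "z \<noteq> 0" for N z
    using prod_weight_eq_Wfun[OF n that, of \<nu>]
    by (simp add: A_def \<alpha>_def b_def[abs_def] d_def m_def)
  have rhs: "meijer_G_n0_0n c n (\<lambda>j. real_of_int (\<nu> j - \<nu> n)) ((cmod z)\<^sup>2)
      = of_real (Gfun m b (ln ((cmod z)\<^sup>2)))" if "z \<noteq> 0" for z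
    using meijer_G_eq_Gfun[of n b c "(cmod z)\<^sup>2"] assms(1) bc that
    by (simp add: b_def[abs_def] m_def)
  show ?thesis
  proof (rule asymp_equivI', rule tendstoI)
    fix e :: real assume e: "e > 0"
    define \<epsilon> where "\<epsilon> = min (e / 2) (1 / 2)"
    have \<epsilon>: "\<epsilon> > 0" "\<epsilon> < e" "\<epsilon> < 1" using e by (auto simp: \<epsilon>_def)
    have "eventually (\<lambda>N. N > 0 \<and> (\<forall>t\<le>T. Wfun m b d N t \<le> ennreal ((1 + \<epsilon>) * Gfun m b t))
        \<and> (\<forall>t\<le>T. ennreal ((1 - \<epsilon>) * Gfun m b t) \<le> Wfun m b d N t)) sequentially"
      by (intro eventually_conj eventually_gt_at_top Wfun_upper Wfun_lower) (use b d \<epsilon> in auto)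
    moreover have "eventually (\<lambda>z. z \<in> K - {0}) (principal (K - {0}))"
      by (simp add: eventually_principal)
    ultimately have "eventually (\<lambda>p. (fst p > 0 \<and> (\<forall>t\<le>T. Wfun m b d (fst p) t \<le> ennreal ((1 + \<epsilon>) * Gfun m b t))
        \<and> (\<forall>t\<le>T. ennreal ((1 - \<epsilon>) * Gfun m b t) \<le> Wfun m b d (fst p) t)) \<and> snd p \<in> K - {0})
        (sequentially \<times>\<^sub>F principal (K - {0}))"
      by (rule eventually_prodI)
    then show "eventually (\<lambda>p. dist ((case p of (N, z) \<Rightarrow> complex_of_real
             (prod_weight n \<nu> N (z / of_real (real N powr (real n / 2))))) /
        (case p of (N, z) \<Rightarrow> of_real (pi ^ (n - 1) / real N powi \<alpha> * cmod z powi (2 * \<nu> n))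
             * meijer_G_n0_0n c n (\<lambda>j. real_of_int (\<nu> j - \<nu> n)) ((cmod z)\<^sup>2))) 1 < e)
        (sequentially \<times>\<^sub>F principal (K - {0}))"
    proof eventually_elim
      case (elim p)
      obtain N z where p: "p = (N, z)" by force
      define t where "t = ln ((cmod z)\<^sup>2)"
      define W where "W = enn2real (Wfun m b d N t)"
      have N: "N > 0" and z: "z \<in> K - {0}" using elim p by auto
      have t: "t \<le> T" unfolding t_def by (rule T[OF z])
      have up: "Wfun m b d N t \<le> ennreal ((1 + \<epsilon>) * Gfun m b t)"
        and low: "ennreal ((1 - \<epsilon>) * Gfun m b t) \<le> Wfun m b d N t"
        using elim t p by auto
      have G: "Gfun m b t > 0" by (rule Gfun_pos)
      have W: "Wfun m b d N t = ennreal W"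
        unfolding W_def using neq_top_trans[OF ennreal_neq_top up]
        by (simp add: ennreal_enn2real_if)
      have "W \<le> (1 + \<epsilon>) * Gfun m b t"
        using up G \<epsilon> unfolding W by (subst (asm) ennreal_le_iff) auto
      moreover have "(1 - \<epsilon>) * Gfun m b t \<le> W"
        using low unfolding W by (subst (asm) ennreal_le_iff) (auto simp: W_def)
      ultimately have "\<bar>W / Gfun m b t - 1\<bar> \<le> \<epsilon>"
        using G by (auto simp: abs_le_iff field_simps)
      then have lt: "\<bar>W / Gfun m b t - 1\<bar> < e" using \<epsilon> by linarith
      have A: "A N z \<noteq> 0" using N z by (simp add: A_def)
      have "(case p of (N, z) \<Rightarrow> complex_of_real
             (prod_weight n \<nu> N (z / of_real (real N powr (real n / 2))))) /
        (case p of (N, z) \<Rightarrow> of_real (pi ^ (n - 1) / real N powi \<alpha> * cmod z powi (2 * \<nu> n))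
             * meijer_G_n0_0n c n (\<lambda>j. real_of_int (\<nu> j - \<nu> n)) ((cmod z)\<^sup>2))
        = of_real (A N z * W) / (of_real (A N z) * of_real (Gfun m b t))"
        using N z by (simp only: p prod.case A_def[symmetric]) (simp add: lhs rhs W_def t_def del: of_int_diff)
      also have "\<dots> = of_real (W / Gfun m b t)" using A by simp
      finally show ?case
        using lt dist_of_real[of "W / Gfun m b t" 1, where ?'a = complex] by (simp add: dist_real_def)
    qed
  qed
qed

end
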